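(* Let $\mathbb{K}$ be a field with $\operatorname{char}(\mathbb{K})=0$, let $G$ be a finite group acting on a nonempty set $E$, let $D=G\times E$ be the associated generalized digroup, and let $Q,W\in\mathsf{Rep}(D)$. If $$\operatorname{Ext}^1_{B_E}(Q,W)^G=0,$$ then every short exact sequence $0\to W\to V\to Q\to 0$ in $\mathsf{Rep}(D)$ splits.
   Context: Let $G$ be a group with identity $1$ acting on the left on a nonempty set $E$, $(g,\alpha)\mapsto g\bullet\alpha$. The associated generalized digroup is $D=G\times E$ with operations $(g,\alpha)\vdash(h,\beta)=(gh,g\bullet\beta)$, $(g,\alpha)\dashv(h,\beta)=(gh,\alpha)$ and halo $\overline{E}=\{(1,\alpha)\mid\alpha\in E\}$. (Every generalized digroup is isomorphic to one of this form.) A representation of $D$ over $\mathbb{K}$ is a triple $(V,\lambda,\rho)$ where $V$ is a $\mathbb{K}$-vector space and $\lambda:D\to\operatorname{End}(V)$, $\rho:D\to\operatorname{Aut}(V)$ are maps such that for all $x,y\in D$ and $e\in\overline{E}$: $\lambda_{x\dashv y}=\lambda_x\lambda_y$, $\rho_{x\vdash y}=\rho_x\rho_y$, $\rho_e=\mathrm{id}_V$, $\rho_x\lambda_y=\lambda_{x\vdash y}$, $\lambda_x\rho_y=\lambda_{x\dashv y}$. A morphism of representations is a $\mathbb{K}$-linear map commuting with all $\lambda_x$ and $\rho_x$. These form the category $\mathsf{Rep}(D)$, which is abelian with enough injectives. For any representation, $\rho_{(g,\alpha)}$ depends only on $g$, is written $\rho_g$, and $g\mapsto\rho_g$ is a representation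 of $G$. The halo algebra $B_E$ is the unital associative $\mathbb{K}$-algebra generated by symbols $\varepsilon_\alpha$ ($\alpha\in E$) subject to $\varepsilon_\alpha\varepsilon_\beta=\varepsilon_\alpha$ for all $\alpha,\beta\in E$. Every representation $(V,\lambda,\rho)$ is a left $B_E$-module via $\varepsilon_\alpha\cdot v=\lambda_{(1,\alpha)}(v)$. The group $G$ acts on $\operatorname{Hom}_{B_E}(Q,W)$ by $(g\cdot f)(q)=\rho_g^W(f((\rho_g^Q)^{-1}(q)))$. The $G$-module structure on $\operatorname{Ext}^1_{B_E}(Q,W)$ is the one induced by this action on the complex $\operatorname{Hom}_{B_E}(Q,I^\bullet)$, where $W\to I^\bullet$ is an injective resolution in $\mathsf{Rep}(D)$, whose underlying complex of $B_E$-modules is an injective resolution of $W$ in $B_E\text{-}\mathsf{Mod}$. The superscript $G$ denotes $G$-invariants. *)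

theory Defs
  imports "HOL-Algebra.Group_Action" "HOL-Algebra.AbelCoset" "HOL-Algebra.Module"
begin

section \<open>The generalized digroup of a group action\<close>

record 'd digroup = "'d partial_object" +
  vdash :: "'d \<Rightarrow> 'd \<Rightarrow> 'd"
  dashv :: "'d \<Rightarrow> 'd \<Rightarrow> 'd"
  halo :: "'d set"

definition action_digroup ::
    "('g, 'n) monoid_scheme \<Rightarrow> 'e set \<Rightarrow> ('g \<Rightarrow> 'e \<Rightarrow> 'e) \<Rightarrow> ('g \<times> 'e) digroup" where
  "action_digroup G E \<phi> =
    \<lparr>carrier = carrier G \<times> E,
     vdash = (\<lambda>(g, a) (h, b). (g \<otimes>\<^bsub>G\<^esub> h, \<phi> g b)),
     dashv = (\<lambda>(g, a) (h, b). (g \<otimes>\<^bsub>G\<^esub> h, a)),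
     halo = {\<one>\<^bsub>G\<^esub>} \<times> E\<rparr>"


section \<open>Representations of a digroup\<close>

text \<open>Vector spaces over the field \<open>K\<close> are modules over \<open>K\<close>. As everywhere in HOL-Algebra, the
  ring product and unit of a module record are not used.\<close>

record ('k, 'd, 'v) digroup_rep = "('k, 'v) module" +
  lam :: "'d \<Rightarrow> 'v \<Rightarrow> 'v"
  rho :: "'d \<Rightarrow> 'v \<Rightarrow> 'v"

definition linear_hom ::
    "('k, 'm) ring_scheme \<Rightarrow> ('k, 'v, 'n) module_scheme \<Rightarrow> ('k, 'w, 'p) module_scheme \<Rightarrow> ('v \<Rightarrow> 'w) set"
  where "linear_hom R V W =
    {f \<in> carrier V \<rightarrow> carrier W.
       (\<forall>u\<in>carrier V. \<forall>v\<in>carrier V. f (u \<oplus>\<^bsub>V\<^esub> v) = f u \<oplus>\<^bsub>W\<^esub> f v) \<and>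
       (\<forall>k\<in>carrier R. \<forall>v\<in>carrier V. f (k \<odot>\<^bsub>V\<^esub> v) = k \<odot>\<^bsub>W\<^esub> f v)}"

locale digroup_representation = K?: field K + module K V
  for K :: "('k, 'm) ring_scheme" (structure) and D :: "'d digroup" and V :: "('k, 'd, 'v) digroup_rep" +
  assumes lam_End: "x \<in> carrier D \<Longrightarrow> lam V x \<in> linear_hom K V V"
    and rho_Aut: "x \<in> carrier D \<Longrightarrow>
      rho V x \<in> linear_hom K V V \<and> bij_betw (rho V x) (carrier V) (carrier V)"
    and lam_dashv: "\<lbrakk>x \<in> carrier D; y \<in> carrier D; v \<in> carrier V\<rbrakk> \<Longrightarrow>
      lam V (dashv D x y) v = lam V x (lam V y v)"
    and rho_vdash: "\<lbrakk>x \<in> carrier D; y \<in> carrier D; v \<in> carrier V\<rbrakk> \<Longrightarrow>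
      rho V (vdash D x y) v = rho V x (rho V y v)"
    and rho_halo: "\<lbrakk>e \<in> halo D; v \<in> carrier V\<rbrakk> \<Longrightarrow> rho V e v = v"
    and rho_lam: "\<lbrakk>x \<in> carrier D; y \<in> carrier D; v \<in> carrier V\<rbrakk> \<Longrightarrow>
      rho V x (lam V y v) = lam V (vdash D x y) v"
    and lam_rho: "\<lbrakk>x \<in> carrier D; y \<in> carrier D; v \<in> carrier V\<rbrakk> \<Longrightarrow>
      lam V x (rho V y v) = lam V (dashv D x y) v"

definition rep_hom ::
    "('k, 'm) ring_scheme \<Rightarrow> 'd digroup \<Rightarrow> ('k, 'd, 'v) digroup_rep \<Rightarrow> ('k, 'd, 'w) digroup_rep
      \<Rightarrow> ('v \<Rightarrow> 'w) set" where
  "rep_hom K D V W =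
    {f \<in> linear_hom K V W. \<forall>x\<in>carrier D. \<forall>v\<in>carrier V.
       f (lam V x v) = lam W x (f v) \<and> f (rho V x v) = rho W x (f v)}"

definition short_exact ::
    "('k, 'm) ring_scheme \<Rightarrow> 'd digroup \<Rightarrow> ('k, 'd, 'w) digroup_rep \<Rightarrow> ('w \<Rightarrow> 'v)
      \<Rightarrow> ('k, 'd, 'v) digroup_rep \<Rightarrow> ('v \<Rightarrow> 'q) \<Rightarrow> ('k, 'd, 'q) digroup_rep \<Rightarrow> bool" where
  "short_exact K D W i V p Q \<longleftrightarrow>
    digroup_representation K D W \<and> digroup_representation K D V \<and> digroup_representation K D Q \<and>
    i \<in> rep_hom K D W V \<and> p \<in> rep_hom K D V Q \<and>
    inj_on i (carrier W) \<and> i ` carrier W = a_kernel V Q p \<and> p ` carrier V = carrier Q"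

definition splits ::
    "('k, 'm) ring_scheme \<Rightarrow> 'd digroup \<Rightarrow> ('k, 'd, 'v) digroup_rep \<Rightarrow> ('v \<Rightarrow> 'q)
      \<Rightarrow> ('k, 'd, 'q) digroup_rep \<Rightarrow> bool" where
  "splits K D V p Q \<longleftrightarrow> (\<exists>s\<in>rep_hom K D Q V. \<forall>q\<in>carrier Q. p (s q) = q)"

text \<open>The operator of a group element: it does not depend on the chosen \<open>a \<in> E\<close>
  (lemma \<open>rho_group_eq\<close> below).\<close>

definition rho_group :: "'e set \<Rightarrow> ('k, 'g \<times> 'e, 'v) digroup_rep \<Rightarrow> 'g \<Rightarrow> 'v \<Rightarrow> 'v" where
  "rho_group E V g = rho V (g, SOME a. a \<in> E)"


section \<open>The halo algebra\<close>

text \<open>The unital associative algebra presented by the generators \<open>Gen a\<close> and the relations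
  \<open>Gen a * Gen b = Gen a\<close>: algebra expressions in the generators, modulo the least congruence that
  contains the axioms of unital associative \<open>K\<close>-algebras and these relations.
  \<open>Scal k\<close> stands for \<open>k\<close> times the unit.\<close>

datatype ('k, 'e) halo_term =
    Scal 'k
  | Gen 'e
  | Plus "('k, 'e) halo_term" "('k, 'e) halo_term"
  | Times "('k, 'e) halo_term" "('k, 'e) halo_term"

inductive_set halo_terms :: "('k, 'm) ring_scheme \<Rightarrow> 'e set \<Rightarrow> ('k, 'e) halo_term set"
  for K :: "('k, 'm) ring_scheme" and E :: "'e set" where
  Scal: "k \<in> carrier K \<Longrightarrow> Scal k \<in> halo_terms K E"
| Gen: "a \<in> E \<Longrightarrow> Gen a \<in> halo_terms K E"
| Plus: "\<lbrakk>s \<in> halo_terms K E; t \<in> halo_terms K E\<rbrakk> \<Longrightarrow> Plus s t \<in> halo_terms K E"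
| Times: "\<lbrakk>s \<in> halo_terms K E; t \<in> halo_terms K E\<rbrakk> \<Longrightarrow> Times s t \<in> halo_terms K E"

inductive halo_eq ::
    "('k, 'm) ring_scheme \<Rightarrow> 'e set \<Rightarrow> ('k, 'e) halo_term \<Rightarrow> ('k, 'e) halo_term \<Rightarrow> bool"
  for K :: "('k, 'm) ring_scheme" and E :: "'e set" where
  refl: "t \<in> halo_terms K E \<Longrightarrow> halo_eq K E t t"
| sym: "halo_eq K E s t \<Longrightarrow> halo_eq K E t s"
| trans: "\<lbrakk>halo_eq K E s t; halo_eq K E t u\<rbrakk> \<Longrightarrow> halo_eq K E s u"
| Plus_cong: "\<lbrakk>halo_eq K E s s'; halo_eq K E t t'\<rbrakk> \<Longrightarrow> halo_eq K E (Plus s t) (Plus s' t')"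
| Times_cong: "\<lbrakk>halo_eq K E s s'; halo_eq K E t t'\<rbrakk> \<Longrightarrow> halo_eq K E (Times s t) (Times s' t')"
| Plus_assoc: "\<lbrakk>s \<in> halo_terms K E; t \<in> halo_terms K E; u \<in> halo_terms K E\<rbrakk> \<Longrightarrow>
    halo_eq K E (Plus (Plus s t) u) (Plus s (Plus t u))"
| Plus_comm: "\<lbrakk>s \<in> halo_terms K E; t \<in> halo_terms K E\<rbrakk> \<Longrightarrow> halo_eq K E (Plus s t) (Plus t s)"
| Plus_zero: "t \<in> halo_terms K E \<Longrightarrow> halo_eq K E (Plus (Scal \<zero>\<^bsub>K\<^esub>) t) t"
| Plus_neg: "t \<in> halo_terms K E \<Longrightarrow>
    halo_eq K E (Plus (Times (Scal (\<ominus>\<^bsub>K\<^esub> \<one>\<^bsub>K\<^esub>)) t) t) (Scal \<zero>\<^bsub>K\<^esub>)"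
| Times_assoc: "\<lbrakk>s \<in> halo_terms K E; t \<in> halo_terms K E; u \<in> halo_terms K E\<rbrakk> \<Longrightarrow>
    halo_eq K E (Times (Times s t) u) (Times s (Times t u))"
| one_Times: "t \<in> halo_terms K E \<Longrightarrow> halo_eq K E (Times (Scal \<one>\<^bsub>K\<^esub>) t) t"
| Plus_Times: "\<lbrakk>s \<in> halo_terms K E; t \<in> halo_terms K E; u \<in> halo_terms K E\<rbrakk> \<Longrightarrow>
    halo_eq K E (Times (Plus s t) u) (Plus (Times s u) (Times t u))"
| Times_Plus: "\<lbrakk>s \<in> halo_terms K E; t \<in> halo_terms K E; u \<in> halo_terms K E\<rbrakk> \<Longrightarrow>
    halo_eq K E (Times u (Plus s t)) (Plus (Times u s) (Times u t))"
| Scal_Plus: "\<lbrakk>k \<in> carrier K; l \<in> carrier K\<rbrakk> \<Longrightarrow>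
    halo_eq K E (Scal (k \<oplus>\<^bsub>K\<^esub> l)) (Plus (Scal k) (Scal l))"
| Scal_Times: "\<lbrakk>k \<in> carrier K; l \<in> carrier K\<rbrakk> \<Longrightarrow>
    halo_eq K E (Scal (k \<otimes>\<^bsub>K\<^esub> l)) (Times (Scal k) (Scal l))"
| Scal_central: "\<lbrakk>k \<in> carrier K; t \<in> halo_terms K E\<rbrakk> \<Longrightarrow>
    halo_eq K E (Times (Scal k) t) (Times t (Scal k))"
| Gen_Gen: "\<lbrakk>a \<in> E; b \<in> E\<rbrakk> \<Longrightarrow> halo_eq K E (Times (Gen a) (Gen b)) (Gen a)"

definition halo_class ::
    "('k, 'm) ring_scheme \<Rightarrow> 'e set \<Rightarrow> ('k, 'e) halo_term \<Rightarrow> ('k, 'e) halo_term set" where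
  "halo_class K E s = {t. halo_eq K E s t}"

definition halo_algebra ::
    "('k, 'm) ring_scheme \<Rightarrow> 'e set \<Rightarrow> ('k, ('k, 'e) halo_term set) module" where
  "halo_algebra K E =
    \<lparr>carrier = halo_class K E ` halo_terms K E,
     mult = (\<lambda>S T. \<Union>s\<in>S. \<Union>t\<in>T. halo_class K E (Times s t)),
     one = halo_class K E (Scal \<one>\<^bsub>K\<^esub>),
     zero = halo_class K E (Scal \<zero>\<^bsub>K\<^esub>),
     add = (\<lambda>S T. \<Union>s\<in>S. \<Union>t\<in>T. halo_class K E (Plus s t)),
     smult = (\<lambda>k T. \<Union>t\<in>T. halo_class K E (Times (Scal k) t))\<rparr>"


section \<open>Left modules over the halo algebra\<close>

text \<open>The module locale of HOL-Algebra requires a commutative ring.\<close>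

locale left_module = B?: ring B + M?: abelian_group M for B (structure) and M (structure) +
  assumes left_smult_closed:
      "\<lbrakk>a \<in> carrier B; x \<in> carrier M\<rbrakk> \<Longrightarrow> a \<odot>\<^bsub>M\<^esub> x \<in> carrier M"
    and left_smult_l_distr: "\<lbrakk>a \<in> carrier B; b \<in> carrier B; x \<in> carrier M\<rbrakk> \<Longrightarrow>
      (a \<oplus>\<^bsub>B\<^esub> b) \<odot>\<^bsub>M\<^esub> x = a \<odot>\<^bsub>M\<^esub> x \<oplus>\<^bsub>M\<^esub> b \<odot>\<^bsub>M\<^esub> x"
    and left_smult_r_distr: "\<lbrakk>a \<in> carrier B; x \<in> carrier M; y \<in> carrier M\<rbrakk> \<Longrightarrow>
      a \<odot>\<^bsub>M\<^esub> (x \<oplus>\<^bsub>M\<^esub> y) = a \<odot>\<^bsub>M\<^esub> x \<oplus>\<^bsub>M\<^esub> a \<odot>\<^bsub>M\<^esub> y"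
    and left_smult_assoc: "\<lbrakk>a \<in> carrier B; b \<in> carrier B; x \<in> carrier M\<rbrakk> \<Longrightarrow>
      (a \<otimes>\<^bsub>B\<^esub> b) \<odot>\<^bsub>M\<^esub> x = a \<odot>\<^bsub>M\<^esub> (b \<odot>\<^bsub>M\<^esub> x)"
    and left_smult_one: "x \<in> carrier M \<Longrightarrow> \<one>\<^bsub>B\<^esub> \<odot>\<^bsub>M\<^esub> x = x"

primrec halo_eval ::
    "('g, 'n) monoid_scheme \<Rightarrow> ('k, 'g \<times> 'e, 'v) digroup_rep \<Rightarrow> ('k, 'e) halo_term \<Rightarrow> 'v \<Rightarrow> 'v" where
  "halo_eval G V (Scal k) v = k \<odot>\<^bsub>V\<^esub> v"
| "halo_eval G V (Gen a) v = lam V (\<one>\<^bsub>G\<^esub>, a) v"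
| "halo_eval G V (Plus s t) v = halo_eval G V s v \<oplus>\<^bsub>V\<^esub> halo_eval G V t v"
| "halo_eval G V (Times s t) v = halo_eval G V s (halo_eval G V t v)"

text \<open>The underlying left module over the halo algebra of a representation. All terms of a class
  act in the same way (lemma \<open>halo_module_smult\<close> below), so the description is proper.\<close>

definition halo_module ::
    "('g, 'n) monoid_scheme \<Rightarrow> ('k, 'g \<times> 'e, 'v) digroup_rep
      \<Rightarrow> (('k, 'e) halo_term set, 'v) module" where
  "halo_module G V =
    \<lparr>carrier = carrier V, mult = mult V, one = one V, zero = zero V, add = add V,
     smult = (\<lambda>T v. THE w. \<exists>t\<in>T. w = halo_eval G V t v)\<rparr>"


section \<open>Injective resolutions\<close>

text \<open>HOL cannot quantify over types inside a formula. The categories of representations and of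
  left modules are therefore formed relative to a universe, namely the type \<open>'u\<close> of the vectors:
  their objects are all structures whose carrier is a subset of \<open>'u\<close>. Monomorphisms are the
  injective morphisms.\<close>

definition rep_injective ::
    "('k, 'm) ring_scheme \<Rightarrow> 'd digroup \<Rightarrow> ('k, 'd, 'u) digroup_rep \<Rightarrow> bool" where
  "rep_injective K D J \<longleftrightarrow> digroup_representation K D J \<and>
    (\<forall>(M :: ('k, 'd, 'u) digroup_rep) (N :: ('k, 'd, 'u) digroup_rep).
       \<forall>i\<in>rep_hom K D M N. \<forall>f\<in>rep_hom K D M J.
         digroup_representation K D M \<and> digroup_representation K D N \<and> inj_on i (carrier M)
         \<longrightarrow> (\<exists>h\<in>rep_hom K D N J. \<forall>x\<in>carrier M. h (i x) = f x))"

definition module_injective ::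
    "('b, 'm) ring_scheme \<Rightarrow> ('b, 'u) module \<Rightarrow> bool" where
  "module_injective B J \<longleftrightarrow> left_module B J \<and>
    (\<forall>(M :: ('b, 'u) module) (N :: ('b, 'u) module).
       \<forall>i\<in>linear_hom B M N. \<forall>f\<in>linear_hom B M J.
         left_module B M \<and> left_module B N \<and> inj_on i (carrier M)
         \<longrightarrow> (\<exists>h\<in>linear_hom B N J. \<forall>x\<in>carrier M. h (i x) = f x))"

text \<open>Exactness of \<open>0 \<rightarrow> W \<rightarrow> I 0 \<rightarrow> I 1 \<rightarrow> I 2 \<rightarrow> \<dots>\<close>\<close>

definition exact_coresolution ::
    "('w, 'm) ring_scheme \<Rightarrow> ('w \<Rightarrow> 'v) \<Rightarrow> (nat \<Rightarrow> ('v, 'n) ring_scheme)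
      \<Rightarrow> (nat \<Rightarrow> 'v \<Rightarrow> 'v) \<Rightarrow> bool" where
  "exact_coresolution W \<eta> I d \<longleftrightarrow>
    inj_on \<eta> (carrier W) \<and> \<eta> ` carrier W = a_kernel (I 0) (I 1) (d 0) \<and>
    (\<forall>n. d n ` carrier (I n) = a_kernel (I (n + 1)) (I (n + 2)) (d (n + 1)))"

definition rep_injective_resolution ::
    "('k, 'm) ring_scheme \<Rightarrow> 'd digroup \<Rightarrow> ('k, 'd, 'u) digroup_rep \<Rightarrow> ('u \<Rightarrow> 'u)
      \<Rightarrow> (nat \<Rightarrow> ('k, 'd, 'u) digroup_rep) \<Rightarrow> (nat \<Rightarrow> 'u \<Rightarrow> 'u) \<Rightarrow> bool" where
  "rep_injective_resolution K D W \<eta> I d \<longleftrightarrow>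
    digroup_representation K D W \<and> (\<forall>n. rep_injective K D (I n)) \<and>
    \<eta> \<in> rep_hom K D W (I 0) \<and> (\<forall>n. d n \<in> rep_hom K D (I n) (I (n + 1))) \<and>
    exact_coresolution W \<eta> I d"

definition module_injective_resolution ::
    "('b, 'm) ring_scheme \<Rightarrow> ('b, 'u) module \<Rightarrow> ('u \<Rightarrow> 'u)
      \<Rightarrow> (nat \<Rightarrow> ('b, 'u) module) \<Rightarrow> (nat \<Rightarrow> 'u \<Rightarrow> 'u) \<Rightarrow> bool" where
  "module_injective_resolution B W \<eta> I d \<longleftrightarrow>
    left_module B W \<and> (\<forall>n. module_injective B (I n)) \<and>
    \<eta> \<in> linear_hom B W (I 0) \<and> (\<forall>n. d n \<in> linear_hom B (I n) (I (n + 1))) \<and>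
    exact_coresolution W \<eta> I d"


section \<open>The first Ext group and its invariants\<close>

text \<open>The additive group of module homomorphisms, written as a monoid record so that its cosets
  can be taken. Its elements are extensional, so that they are determined by their values on the
  carrier.\<close>

definition Hom_group :: "('b, 'm) ring_scheme \<Rightarrow> ('b, 'v) module \<Rightarrow> ('b, 'w) module \<Rightarrow> ('v \<Rightarrow> 'w) monoid"
  where "Hom_group B Q W =
    \<lparr>carrier = linear_hom B Q W \<inter> extensional (carrier Q),
     mult = (\<lambda>f h. \<lambda>q\<in>carrier Q. f q \<oplus>\<^bsub>W\<^esub> h q),
     one = (\<lambda>q\<in>carrier Q. \<zero>\<^bsub>W\<^esub>)\<rparr>"

text \<open>The first cohomology of \<open>Hom(Q, I 0) \<rightarrow> Hom(Q, I 1) \<rightarrow> Hom(Q, I 2)\<close>. It is the first Ext group of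
  \<open>Q\<close> and \<open>W\<close> if \<open>I\<close> with the differentials \<open>d\<close> is an injective resolution of \<open>W\<close>.\<close>

definition Ext1 ::
    "('b, 'm) ring_scheme \<Rightarrow> ('b, 'q) module \<Rightarrow> (nat \<Rightarrow> ('b, 'u) module) \<Rightarrow> (nat \<Rightarrow> 'u \<Rightarrow> 'u)
      \<Rightarrow> ('q \<Rightarrow> 'u) set monoid" where
  "Ext1 B Q I d =
    (Hom_group B Q (I 1)
      \<lparr>carrier := kernel (Hom_group B Q (I 1)) (Hom_group B Q (I 2)) (compose (carrier Q) (d 1))\<rparr>)
    Mod (compose (carrier Q) (d 0) ` carrier (Hom_group B Q (I 0)))"

definition hom_act ::
    "'e set \<Rightarrow> ('k, 'g \<times> 'e, 'v) digroup_rep \<Rightarrow> ('k, 'g \<times> 'e, 'w) digroup_rep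
      \<Rightarrow> 'g \<Rightarrow> ('v \<Rightarrow> 'w) \<Rightarrow> 'v \<Rightarrow> 'w" where
  "hom_act E Q W g f =
    (\<lambda>q\<in>carrier Q. rho_group E W g (f (inv_into (carrier Q) (rho_group E Q g) q)))"

definition halo_Ext1 ::
    "('k, 'm) ring_scheme \<Rightarrow> ('g, 'n) monoid_scheme \<Rightarrow> 'e set \<Rightarrow> ('k, 'g \<times> 'e, 'u) digroup_rep
      \<Rightarrow> (nat \<Rightarrow> ('k, 'g \<times> 'e, 'u) digroup_rep) \<Rightarrow> (nat \<Rightarrow> 'u \<Rightarrow> 'u) \<Rightarrow> ('u \<Rightarrow> 'u) set monoid" where
  "halo_Ext1 K G E Q I d =
    Ext1 (halo_algebra K E) (halo_module G Q) (\<lambda>n. halo_module G (I n)) d"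

text \<open>A group element acts on a cohomology class by acting on all of its members.\<close>

definition halo_Ext1_invariants ::
    "('k, 'm) ring_scheme \<Rightarrow> ('g, 'n) monoid_scheme \<Rightarrow> 'e set \<Rightarrow> ('k, 'g \<times> 'e, 'u) digroup_rep
      \<Rightarrow> (nat \<Rightarrow> ('k, 'g \<times> 'e, 'u) digroup_rep) \<Rightarrow> (nat \<Rightarrow> 'u \<Rightarrow> 'u) \<Rightarrow> ('u \<Rightarrow> 'u) set set" where
  "halo_Ext1_invariants K G E Q I d =
    {c \<in> carrier (halo_Ext1 K G E Q I d). \<forall>g\<in>carrier G. hom_act E Q (I 1) g ` c = c}"


section \<open>Well-definedness\<close>

lemma halo_eq_terms:
  assumes "halo_eq K E s t" "ring K"
  shows "s \<in> halo_terms K E \<and> t \<in> halo_terms K E"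
proof -
  interpret ring K by fact
  show ?thesis using assms(1)
    by induction (auto intro!: halo_terms.intros)
qed

lemma halo_class_eq_iff:
  assumes "s \<in> halo_terms K E" "t \<in> halo_terms K E"
  shows "halo_class K E s = halo_class K E t \<longleftrightarrow> halo_eq K E s t"
proof
  assume "halo_class K E s = halo_class K E t"
  moreover have "t \<in> halo_class K E t"
    using assms(2) by (simp add: halo_class_def halo_eq.refl)
  ultimately show "halo_eq K E s t" by (simp add: halo_class_def set_eq_iff)
next
  assume st: "halo_eq K E s t"
  have "halo_eq K E s u \<longleftrightarrow> halo_eq K E t u" for u
    using halo_eq.trans[OF st] halo_eq.trans[OF halo_eq.sym[OF st]] by iprover
  then show "halo_class K E s = halo_class K E t" by (simp add: halo_class_def)
qed

lemma halo_class_eqI: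
  assumes "halo_eq K E s t"
  shows "halo_class K E t = halo_class K E s"
proof -
  have "halo_eq K E s u \<longleftrightarrow> halo_eq K E t u" for u
    using halo_eq.trans[OF assms] halo_eq.trans[OF halo_eq.sym[OF assms]] by iprover
  then show ?thesis by (simp add: halo_class_def)
qed

lemma UN_constI:
  assumes "\<And>t. t \<in> T \<Longrightarrow> f t = c" "T \<noteq> {}"
  shows "(\<Union>t\<in>T. f t) = c"
  using assms by simp

lemma UN2_const:
  assumes "\<And>s t. \<lbrakk>s \<in> S; t \<in> T\<rbrakk> \<Longrightarrow> f s t = c" "S \<noteq> {}" "T \<noteq> {}"
  shows "(\<Union>s\<in>S. \<Union>t\<in>T. f s t) = c"
  using assms by simp

lemma halo_class_mem: "t \<in> halo_class K E s \<longleftrightarrow> halo_eq K E s t"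
  by (simp add: halo_class_def)

lemma halo_add_class:
  assumes "s \<in> halo_terms K E" "t \<in> halo_terms K E"
  shows "halo_class K E s \<oplus>\<^bsub>halo_algebra K E\<^esub> halo_class K E t = halo_class K E (Plus s t)"
proof -
  have "(\<Union>s'\<in>halo_class K E s. \<Union>t'\<in>halo_class K E t. halo_class K E (Plus s' t')) =
      halo_class K E (Plus s t)"
  proof (rule UN2_const)
    fix s' t' assume "s' \<in> halo_class K E s" "t' \<in> halo_class K E t"
    then show "halo_class K E (Plus s' t') = halo_class K E (Plus s t)"
      unfolding halo_class_mem by (rule halo_class_eqI[OF halo_eq.Plus_cong])
  next
    show "halo_class K E s \<noteq> {}" "halo_class K E t \<noteq> {}"
      using halo_eq.refl[OF assms(1)] halo_eq.refl[OF assms(2)] by (auto simp: halo_class_def)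
  qed
  then show ?thesis by (simp add: halo_algebra_def)
qed

lemma halo_mult_class:
  assumes "s \<in> halo_terms K E" "t \<in> halo_terms K E"
  shows "halo_class K E s \<otimes>\<^bsub>halo_algebra K E\<^esub> halo_class K E t = halo_class K E (Times s t)"
proof -
  have "(\<Union>s'\<in>halo_class K E s. \<Union>t'\<in>halo_class K E t. halo_class K E (Times s' t')) =
      halo_class K E (Times s t)"
  proof (rule UN2_const)
    fix s' t' assume "s' \<in> halo_class K E s" "t' \<in> halo_class K E t"
    then show "halo_class K E (Times s' t') = halo_class K E (Times s t)"
      unfolding halo_class_mem by (rule halo_class_eqI[OF halo_eq.Times_cong])
  next
    show "halo_class K E s \<noteq> {}" "halo_class K E t \<noteq> {}"
      using halo_eq.refl[OF assms(1)] halo_eq.refl[OF assms(2)] by (auto simp: halo_class_def)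
  qed
  then show ?thesis by (simp add: halo_algebra_def)
qed

lemma halo_smult_class:
  assumes "k \<in> carrier K" "t \<in> halo_terms K E"
  shows "k \<odot>\<^bsub>halo_algebra K E\<^esub> halo_class K E t = halo_class K E (Times (Scal k) t)"
proof -
  have "(\<Union>t'\<in>halo_class K E t. halo_class K E (Times (Scal k) t')) =
      halo_class K E (Times (Scal k) t)"
  proof (rule UN_constI)
    fix t' assume "t' \<in> halo_class K E t"
    then show "halo_class K E (Times (Scal k) t') = halo_class K E (Times (Scal k) t)"
      unfolding halo_class_mem
      by (rule halo_class_eqI[OF halo_eq.Times_cong[OF halo_eq.refl[OF halo_terms.Scal[OF assms(1)]]]])
  next
    show "halo_class K E t \<noteq> {}"
      using halo_eq.refl[OF assms(2)] by (auto simp: halo_class_def)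
  qed
  then show ?thesis by (simp add: halo_algebra_def)
qed

lemma halo_algebra_carrier: "carrier (halo_algebra K E) = halo_class K E ` halo_terms K E"
  and halo_algebra_one: "\<one>\<^bsub>halo_algebra K E\<^esub> = halo_class K E (Scal \<one>\<^bsub>K\<^esub>)"
  and halo_algebra_zero: "\<zero>\<^bsub>halo_algebra K E\<^esub> = halo_class K E (Scal \<zero>\<^bsub>K\<^esub>)"
  by (simp_all add: halo_algebra_def)

lemmas halo_algebra_simps =
  halo_algebra_carrier halo_algebra_one halo_algebra_zero
  halo_add_class halo_mult_class halo_smult_class halo_class_eq_iff

lemma halo_algebra_ring:
  assumes "cring K"
  shows "ring (halo_algebra K E)"
proof -
  interpret cring K by fact
  note [simp, intro] = halo_terms.intros
  note [rule del] = equalityI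
  note [simp] = halo_algebra_simps
  show ?thesis
  proof (rule ringI)
    show "abelian_group (halo_algebra K E)"
    proof (rule abelian_groupI)
      fix x assume "x \<in> carrier (halo_algebra K E)"
      then obtain t where t: "t \<in> halo_terms K E" "x = halo_class K E t" by auto
      then show "\<exists>y\<in>carrier (halo_algebra K E). y \<oplus>\<^bsub>halo_algebra K E\<^esub> x = \<zero>\<^bsub>halo_algebra K E\<^esub>"
        by (intro bexI[of _ "halo_class K E (Times (Scal (\<ominus>\<^bsub>K\<^esub> \<one>\<^bsub>K\<^esub>)) t)"])
           (auto intro!: halo_eq.Plus_neg)
    qed (auto intro!: halo_eq.Plus_assoc halo_eq.Plus_comm halo_eq.Plus_zero)
    show "monoid (halo_algebra K E)"
    proof (rule monoidI)
      fix x assume "x \<in> carrier (halo_algebra K E)"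
      then show "x \<otimes>\<^bsub>halo_algebra K E\<^esub> \<one>\<^bsub>halo_algebra K E\<^esub> = x"
        by (auto intro!: halo_eq.trans[OF halo_eq.sym[OF halo_eq.Scal_central] halo_eq.one_Times])
    qed (auto intro!: halo_eq.Times_assoc halo_eq.one_Times)
  qed (auto intro!: halo_eq.Plus_Times halo_eq.Times_Plus)
qed

lemma halo_algebra_module:
  assumes "cring K"
  shows "module K (halo_algebra K E)"
proof -
  interpret cring K by fact
  interpret H: ring "halo_algebra K E" by (rule halo_algebra_ring) fact
  note [simp, intro] = halo_terms.intros
  note [rule del] = equalityI
  note [simp] = halo_algebra_simps
  show ?thesis
  proof (rule moduleI)
    show "abelian_group (halo_algebra K E)" ..
    fix a b x assume ab: "a \<in> carrier K" "b \<in> carrier K" and "x \<in> carrier (halo_algebra K E)"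
    then obtain t where t: "t \<in> halo_terms K E" "x = halo_class K E t" by auto
    have "halo_eq K E (Times (Scal (a \<oplus>\<^bsub>K\<^esub> b)) t) (Times (Plus (Scal a) (Scal b)) t)"
      "halo_eq K E (Times (Scal (a \<otimes>\<^bsub>K\<^esub> b)) t) (Times (Times (Scal a) (Scal b)) t)"
      using ab t by (auto intro!: halo_eq.Times_cong halo_eq.Scal_Plus halo_eq.Scal_Times halo_eq.refl)
    then show "(a \<oplus>\<^bsub>K\<^esub> b) \<odot>\<^bsub>halo_algebra K E\<^esub> x =
        a \<odot>\<^bsub>halo_algebra K E\<^esub> x \<oplus>\<^bsub>halo_algebra K E\<^esub> b \<odot>\<^bsub>halo_algebra K E\<^esub> x"
      and "(a \<otimes>\<^bsub>K\<^esub> b) \<odot>\<^bsub>halo_algebra K E\<^esub> x =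
        a \<odot>\<^bsub>halo_algebra K E\<^esub> (b \<odot>\<^bsub>halo_algebra K E\<^esub> x)"
      using ab t by (auto intro: halo_eq.trans halo_eq.Plus_Times halo_eq.Times_assoc)
  qed (auto simp: cring_axioms intro!: halo_eq.Times_Plus halo_eq.one_Times)
qed

lemma halo_algebra_smult_mult:
  assumes "cring K" "k \<in> carrier K"
    and "x \<in> carrier (halo_algebra K E)" "y \<in> carrier (halo_algebra K E)"
  shows "(k \<odot>\<^bsub>halo_algebra K E\<^esub> x) \<otimes>\<^bsub>halo_algebra K E\<^esub> y =
      k \<odot>\<^bsub>halo_algebra K E\<^esub> (x \<otimes>\<^bsub>halo_algebra K E\<^esub> y)"
    and "x \<otimes>\<^bsub>halo_algebra K E\<^esub> (k \<odot>\<^bsub>halo_algebra K E\<^esub> y) =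
      k \<odot>\<^bsub>halo_algebra K E\<^esub> (x \<otimes>\<^bsub>halo_algebra K E\<^esub> y)"
proof -
  note [simp, intro] = halo_terms.intros
  note [rule del] = equalityI
  note [simp] = halo_algebra_simps
  from assms obtain s t where st: "s \<in> halo_terms K E" "x = halo_class K E s"
    "t \<in> halo_terms K E" "y = halo_class K E t" by auto
  then show "(k \<odot>\<^bsub>halo_algebra K E\<^esub> x) \<otimes>\<^bsub>halo_algebra K E\<^esub> y =
      k \<odot>\<^bsub>halo_algebra K E\<^esub> (x \<otimes>\<^bsub>halo_algebra K E\<^esub> y)"
    using assms(2) by (auto intro!: halo_eq.Times_assoc)
  have "halo_eq K E (Times s (Times (Scal k) t)) (Times (Times s (Scal k)) t)"
    "halo_eq K E (Times (Times s (Scal k)) t) (Times (Times (Scal k) s) t)"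
    "halo_eq K E (Times (Times (Scal k) s) t) (Times (Scal k) (Times s t))"
    using assms(2) st
    by (simp_all add: halo_eq.Times_assoc halo_eq.sym[OF halo_eq.Times_assoc] halo_eq.Times_cong
        halo_eq.sym[OF halo_eq.Scal_central] halo_eq.refl)
  then show "x \<otimes>\<^bsub>halo_algebra K E\<^esub> (k \<odot>\<^bsub>halo_algebra K E\<^esub> y) =
      k \<odot>\<^bsub>halo_algebra K E\<^esub> (x \<otimes>\<^bsub>halo_algebra K E\<^esub> y)"
    using assms(2) st by (auto intro: halo_eq.trans)
qed

locale action_representation = group_action G E \<phi> + digroup_representation K "action_digroup G E \<phi>" V
  for G :: "('g, 'n) monoid_scheme" (structure) and E :: "'e set" and \<phi>
    and K :: "('k, 'm) ring_scheme" (structure) and V :: "('k, 'g \<times> 'e, 'v) digroup_rep"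
begin

lemma one_in_carrier: "\<one>\<^bsub>G\<^esub> \<in> carrier G"
  using group_hom by (simp add: group_hom_def group.is_monoid monoid.one_closed)

lemma lam_one_linear:
  assumes "a \<in> E"
  shows "lam V (\<one>\<^bsub>G\<^esub>, a) \<in> linear_hom K V V"
  using lam_End[of "(\<one>\<^bsub>G\<^esub>, a)"] assms one_in_carrier by (simp add: action_digroup_def)

lemma lam_one_lam_one:
  assumes "a \<in> E" "b \<in> E" "v \<in> carrier V"
  shows "lam V (\<one>\<^bsub>G\<^esub>, a) (lam V (\<one>\<^bsub>G\<^esub>, b) v) = lam V (\<one>\<^bsub>G\<^esub>, a) v"
proof -
  have "\<one>\<^bsub>G\<^esub> \<otimes>\<^bsub>G\<^esub> \<one>\<^bsub>G\<^esub> = \<one>\<^bsub>G\<^esub>"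
    using group_hom by (simp add: group_hom_def group.is_monoid monoid.l_one monoid.one_closed)
  then show ?thesis
    using lam_dashv[of "(\<one>\<^bsub>G\<^esub>, a)" "(\<one>\<^bsub>G\<^esub>, b)" v] assms one_in_carrier
    by (simp add: action_digroup_def)
qed

lemma halo_eval_linear:
  assumes "t \<in> halo_terms K E"
  shows "halo_eval G V t \<in> linear_hom K V V"
  using assms
proof induction
  case (Scal k)
  then show ?case
    by (auto simp: linear_hom_def smult_r_distr smult_assoc1[symmetric] K.m_comm)
next
  case (Gen a)
  then show ?case using lam_one_linear[of a] by (simp add: linear_hom_def Pi_iff)
next
  case (Plus s t)
  then show ?case
    by (simp add: linear_hom_def Pi_iff smult_r_distr M.a_ac)
next
  case (Times s t)
  then show ?case by (simp add: linear_hom_def Pi_iff)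
qed

lemma halo_eval_closed:
  "\<lbrakk>t \<in> halo_terms K E; v \<in> carrier V\<rbrakk> \<Longrightarrow> halo_eval G V t v \<in> carrier V"
  using halo_eval_linear[of t] by (auto simp: linear_hom_def)

lemma halo_eval_cong:
  assumes "halo_eq K E s t" "v \<in> carrier V"
  shows "halo_eval G V s v = halo_eval G V t v"
  using assms
proof (induction arbitrary: v)
  case (Plus_assoc s t u)
  then show ?case by (simp add: halo_eval_closed M.a_assoc)
next
  case (Plus_comm s t)
  then show ?case by (simp add: halo_eval_closed M.a_comm)
next
  case (Plus_zero t)
  then have "\<zero>\<^bsub>K\<^esub> \<odot>\<^bsub>V\<^esub> v = \<zero>\<^bsub>V\<^esub>" by (simp add: smult_l_null)
  with Plus_zero show ?case by (simp add: halo_eval_closed)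
next
  case (Plus_neg t)
  then show ?case by (simp add: halo_eval_closed smult_l_minus smult_l_null M.l_neg)
next
  case (Times_Plus s t u)
  then show ?case
    using halo_eval_linear[of u] by (simp add: linear_hom_def halo_eval_closed)
next
  case (Scal_central k t)
  then show ?case using halo_eval_linear[of t] by (simp add: linear_hom_def)
next
  case (Times_cong s s' t t')
  then show ?case
    by (metis halo_eq_terms halo_eval.simps(4) halo_eval_closed K.ring_axioms)
qed (simp_all add: halo_eval_closed smult_l_distr smult_assoc1 lam_one_lam_one)

lemma halo_module_smult:
  assumes "t \<in> halo_terms K E" "v \<in> carrier V"
  shows "halo_class K E t \<odot>\<^bsub>halo_module G V\<^esub> v = halo_eval G V t v"
proof -
  have "t \<in> halo_class K E t" using assms by (auto simp: halo_class_def intro: halo_eq.refl)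
  then show ?thesis
    using assms by (auto simp: halo_module_def halo_class_def intro!: the_equality dest: halo_eval_cong)
qed

lemma halo_module_left_module: "left_module (halo_algebra K E) (halo_module G V)"
proof -
  interpret H: ring "halo_algebra K E" by (rule halo_algebra_ring) (rule K.cring_axioms)
  note [simp, intro] = halo_terms.intros
  note [rule del] = equalityI
  have [simp]: "carrier (halo_module G V) = carrier V" "add (halo_module G V) = add V"
    "zero (halo_module G V) = zero V"
    by (simp_all add: halo_module_def)
  show ?thesis
  proof (intro left_module.intro left_module_axioms.intro)
    show "ring (halo_algebra K E)" ..
    show "abelian_group (halo_module G V)"
      by (rule abelian_groupI) (auto simp: M.a_assoc intro: M.a_comm M.l_neg)
  next
    fix a x y assume "a \<in> carrier (halo_algebra K E)"
      and xy: "x \<in> carrier (halo_module G V)" "y \<in> carrier (halo_module G V)"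
    then obtain t where "t \<in> halo_terms K E" "a = halo_class K E t"
      by (auto simp: halo_algebra_carrier)
    with xy show "a \<odot>\<^bsub>halo_module G V\<^esub> (x \<oplus>\<^bsub>halo_module G V\<^esub> y) =
        a \<odot>\<^bsub>halo_module G V\<^esub> x \<oplus>\<^bsub>halo_module G V\<^esub> a \<odot>\<^bsub>halo_module G V\<^esub> y"
      using halo_eval_linear[of t] by (simp add: halo_module_smult linear_hom_def)
  qed (auto simp: halo_algebra_simps halo_module_smult halo_eval_closed)
qed

lemma rho_group_eq:
  assumes "g \<in> carrier G" "a \<in> E" "v \<in> carrier V"
  shows "rho_group E V g v = rho V (g, a) v"
proof -
  have eq: "rho V (g, c) v = rho V (g, a) v" if "c \<in> E" for c
  proof -
    interpret grp: group G using group_hom by (simp add: group_hom_def)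
    have "c \<in> \<phi> g ` E" using that by (simp only: surj_prop[OF assms(1)])
    then obtain b where b: "b \<in> E" "\<phi> g b = c" by blast
    have "rho V (g, c) v = rho V (g, a) (rho V (\<one>\<^bsub>G\<^esub>, b) v)"
      using rho_vdash[of "(g, a)" "(\<one>\<^bsub>G\<^esub>, b)" v] assms b by (simp add: action_digroup_def)
    then show ?thesis
      using rho_halo[of "(\<one>\<^bsub>G\<^esub>, b)" v] assms b by (simp add: action_digroup_def)
  qed
  have "(SOME a. a \<in> E) \<in> E" using assms(2) by (rule someI)
  then show ?thesis unfolding rho_group_def by (rule eq)
qed

end

end

theory Submission
  imports Defs
begin

text \<open>
  An extension \<open>0 \<rightarrow> W \<rightarrow> V \<rightarrow> Q \<rightarrow> 0\<close>, with maps \<open>i\<close> and \<open>p\<close>, has a class in the first Ext group over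
  the halo algebra, and this class is \<open>G\<close>-invariant because a cocycle that represents it can be
  chosen among the morphisms of representations: injectivity of \<open>I 0\<close> among representations extends
  \<open>\<eta>\<close> along \<open>i\<close> to a morphism \<open>h : V \<rightarrow> I 0\<close>, and \<open>d 0 \<circ> h\<close> vanishes on \<open>i W = ker p\<close>, hence equals
  \<open>c \<circ> p\<close> for a morphism \<open>c : Q \<rightarrow> I 1\<close> with \<open>d 1 \<circ> c = 0\<close>
  (lemma \<open>rep_hom_factor_through_surj\<close>). Since the invariants of Ext vanish, \<open>c = d 0 \<circ> f\<close> for a map
  \<open>f : Q \<rightarrow> I 0\<close> that is linear over the halo algebra
  (lemma \<open>equivariant_cocycle_is_coboundary\<close>).

  A map that is linear over the halo algebra is a morphism of representations exactly when it
  commutes with all \<open>rho g\<close> (lemma \<open>rep_hom_iff\<close>), so \<open>f\<close> may fail to be one. This is repaired as in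
  Maschke's theorem: in characteristic zero the mean \<open>f'\<close> of the translates of \<open>f\<close> under the finite
  group \<open>G\<close> exists. It is equivariant (lemma \<open>average_rep_hom\<close>), and still \<open>d 0 \<circ> f' = c\<close>, because
  \<open>d 0\<close> and \<open>c\<close> are equivariant (lemma \<open>average_lifts_rep_hom\<close>).

  Now \<open>h - f' \<circ> p\<close> is a morphism \<open>V \<rightarrow> I 0\<close> that is killed by \<open>d 0\<close> and restricts to \<open>\<eta>\<close> on \<open>W\<close>. By
  exactness at \<open>I 0\<close> it has its values in \<open>\<eta> W\<close>, so it is \<open>\<eta> \<circ> r\<close> for a morphism \<open>r : V \<rightarrow> W\<close>
  (lemma \<open>rep_hom_lift_through_inj\<close>), and \<open>r \<circ> i\<close> is the identity. A retraction of \<open>i\<close> splits the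
  sequence (lemma \<open>splits_if_retraction\<close>).
\<close>

section \<open>Linear maps and morphisms of representations\<close>

lemma linear_homD:
  assumes "f \<in> linear_hom R V W"
  shows "v \<in> carrier V \<Longrightarrow> f v \<in> carrier W"
    and "\<lbrakk>u \<in> carrier V; v \<in> carrier V\<rbrakk> \<Longrightarrow> f (u \<oplus>\<^bsub>V\<^esub> v) = f u \<oplus>\<^bsub>W\<^esub> f v"
    and "\<lbrakk>k \<in> carrier R; v \<in> carrier V\<rbrakk> \<Longrightarrow> f (k \<odot>\<^bsub>V\<^esub> v) = k \<odot>\<^bsub>W\<^esub> f v"
  using assms by (auto simp: linear_hom_def)

lemma linear_hom_abelian_group_hom:
  assumes "abelian_group V" "abelian_group W" "f \<in> linear_hom R V W"
  shows "abelian_group_hom V W f"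
  using assms
  by (intro abelian_group_homI group_hom.intro group_hom_axioms.intro)
     (auto simp: linear_hom_def hom_def intro: abelian_group.a_group)

lemma linear_hom_finsum:
  assumes "abelian_group V" "abelian_group W" "f \<in> linear_hom R V W" "x \<in> A \<rightarrow> carrier V"
  shows "f (\<Oplus>\<^bsub>V\<^esub>a\<in>A. x a) = (\<Oplus>\<^bsub>W\<^esub>a\<in>A. f (x a))"
proof -
  interpret V: abelian_group V by fact
  interpret W: abelian_group W by fact
  interpret abelian_group_hom V W f by (rule linear_hom_abelian_group_hom) fact+
  from assms(4) show ?thesis
  proof (induction A rule: infinite_finite_induct)
    case (insert a A)
    then have "x a \<in> carrier V" "x \<in> A \<rightarrow> carrier V" by auto
    moreover have "(\<lambda>a. f (x a)) \<in> A \<rightarrow> carrier W"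
      using insert.prems linear_homD(1)[OF assms(3)] by (auto simp: Pi_iff)
    ultimately show ?case
      using insert by (simp add: V.finsum_closed)
  qed simp_all
qed

lemma (in module) finsum_const_smult:
  assumes "x \<in> carrier M"
  shows "(\<Oplus>\<^bsub>M\<^esub>a\<in>A. x) = ([card A] \<cdot> \<one>) \<odot>\<^bsub>M\<^esub> x"
proof -
  have "add_pow M (n::nat) x = ([n] \<cdot> \<one>) \<odot>\<^bsub>M\<^esub> x" for n
    by (induction n) (simp_all add: assms smult_l_distr M.add.nat_pow_Suc R.add.nat_pow_Suc)
  then show ?thesis using assms by (simp add: M.add.finprod_const)
qed

lemma rep_hom_linear: "f \<in> rep_hom K D V W \<Longrightarrow> f \<in> linear_hom K V W"
  by (simp add: rep_hom_def)

lemma rep_homD: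
  assumes "f \<in> rep_hom K D V W" "x \<in> carrier D" "v \<in> carrier V"
  shows "f (lam V x v) = lam W x (f v)" and "f (rho V x v) = rho W x (f v)"
  using assms by (simp_all add: rep_hom_def)

lemma digroup_representation_modules:
  assumes "digroup_representation K D V"
  shows "module K V" and "abelian_group V"
  using assms unfolding digroup_representation_def by (auto simp: module_def)

lemma digroup_representation_operators:
  assumes "digroup_representation K D V" "x \<in> carrier D"
  shows "lam V x \<in> linear_hom K V V" and "rho V x \<in> linear_hom K V V"
  using assms by (auto simp: digroup_representation.lam_End digroup_representation.rho_Aut)

lemma rep_hom_comp:
  assumes "f \<in> rep_hom K D U V" "g \<in> rep_hom K D V W"
  shows "(\<lambda>u. g (f u)) \<in> rep_hom K D U W"
  using assms by (auto simp: rep_hom_def linear_hom_def Pi_iff)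

lemma linear_hom_diff:
  assumes "module K V" "module K W" "f \<in> linear_hom K V W" "g \<in> linear_hom K V W"
  shows "(\<lambda>v. f v \<ominus>\<^bsub>W\<^esub> g v) \<in> linear_hom K V W"
proof -
  interpret V: module K V by fact
  interpret W: module K W by fact
  note [simp] = linear_homD[OF assms(3)] linear_homD[OF assms(4)]
  show ?thesis
    by (auto simp: linear_hom_def a_minus_def W.M.minus_add W.M.a_ac W.smult_r_distr W.smult_r_minus)
qed

lemma linear_hom_minus_apply:
  assumes "abelian_group V" "abelian_group W" "f \<in> linear_hom K V W" "u \<in> carrier V" "v \<in> carrier V"
  shows "f (u \<ominus>\<^bsub>V\<^esub> v) = f u \<ominus>\<^bsub>W\<^esub> f v"
proof -
  interpret V: abelian_group V by fact
  interpret W: abelian_group W by fact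
  interpret abelian_group_hom V W f by (rule linear_hom_abelian_group_hom) fact+
  show ?thesis using assms(4,5) by (simp add: a_minus_def)
qed

lemma rep_hom_diff:
  assumes V: "digroup_representation K D V" and W: "digroup_representation K D W"
    and f: "f \<in> rep_hom K D V W" and g: "g \<in> rep_hom K D V W"
  shows "(\<lambda>v. f v \<ominus>\<^bsub>W\<^esub> g v) \<in> rep_hom K D V W"
  using linear_hom_diff[OF digroup_representation_modules(1)[OF V]
      digroup_representation_modules(1)[OF W] f[THEN rep_hom_linear] g[THEN rep_hom_linear]]
    linear_homD(1)[OF f[THEN rep_hom_linear]] linear_homD(1)[OF g[THEN rep_hom_linear]]
    linear_hom_minus_apply[OF digroup_representation_modules(2)[OF W]
      digroup_representation_modules(2)[OF W] digroup_representation_operators(1)[OF W]]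
    linear_hom_minus_apply[OF digroup_representation_modules(2)[OF W]
      digroup_representation_modules(2)[OF W] digroup_representation_operators(2)[OF W]]
  by (simp add: rep_hom_def[of K D V W] rep_homD[OF f] rep_homD[OF g])

text \<open>The universal property of the cokernel: \<open>p\<close> presents \<open>Q\<close> as the quotient of \<open>V\<close> by its kernel.
  The compatibilities of the induced map are inherited from \<open>h\<close> because every element of \<open>Q\<close> is some
  \<open>p v\<close>.\<close>

lemma rep_hom_factor_through_surj:
  assumes V: "digroup_representation K D V" and Q: "digroup_representation K D Q"
    and J: "digroup_representation K D J"
    and p: "p \<in> rep_hom K D V Q" and surj: "p ` carrier V = carrier Q"
    and h: "h \<in> rep_hom K D V J"
    and ker: "\<And>v. v \<in> a_kernel V Q p \<Longrightarrow> h v = \<zero>\<^bsub>J\<^esub>"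
  obtains c where "c \<in> rep_hom K D Q J" "\<And>v. v \<in> carrier V \<Longrightarrow> c (p v) = h v"
proof -
  interpret V: digroup_representation K D V by fact
  interpret Q: digroup_representation K D Q by fact
  interpret J: digroup_representation K D J by fact
  note pl = rep_hom_linear[OF p] and hl = rep_hom_linear[OF h]
  note [simp] = linear_homD(1)[OF pl] linear_homD(1)[OF hl]
  define c where "c = (\<lambda>q. h (inv_into (carrier V) p q))"
  have eq: "h u = h v" if uv: "u \<in> carrier V" "v \<in> carrier V" "p u = p v" for u v
  proof -
    have "p (u \<ominus>\<^bsub>V\<^esub> v) = \<zero>\<^bsub>Q\<^esub>"
      using uv linear_hom_minus_apply[OF V.abelian_group_axioms Q.abelian_group_axioms pl, of u v]
      by (simp add: a_minus_def Q.M.r_neg)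
    then have "h (u \<ominus>\<^bsub>V\<^esub> v) = \<zero>\<^bsub>J\<^esub>"
      using uv by (intro ker) (simp add: a_kernel_def')
    then have "h u \<ominus>\<^bsub>J\<^esub> h v = \<zero>\<^bsub>J\<^esub>"
      using uv linear_hom_minus_apply[OF V.abelian_group_axioms J.abelian_group_axioms hl, of u v] by simp
    then show "h u = h v"
      using uv by (metis J.M.add.inv_closed J.M.minus_minus J.M.minus_equality a_minus_def linear_homD(1)[OF hl])
  qed
  have cp: "c (p v) = h v" if "v \<in> carrier V" for v
    unfolding c_def using that by (intro eq) (auto intro: inv_into_into f_inv_into_f)
  have lift: "\<exists>v\<in>carrier V. q = p v" if "q \<in> carrier Q" for q
    using that surj by blast
  have "c \<in> rep_hom K D Q J"
    unfolding rep_hom_def linear_hom_def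
  proof (intro CollectI conjI ballI Pi_I)
    fix q assume "q \<in> carrier Q"
    then show "c q \<in> carrier J" using lift[of q] cp by auto
  next
    fix q q' assume "q \<in> carrier Q" "q' \<in> carrier Q"
    then obtain v v' where v: "v \<in> carrier V" "q = p v" "v' \<in> carrier V" "q' = p v'"
      using lift by meson
    have "c (p (v \<oplus>\<^bsub>V\<^esub> v')) = h v \<oplus>\<^bsub>J\<^esub> h v'"
      using v by (simp add: cp linear_homD(2)[OF hl])
    with v show "c (q \<oplus>\<^bsub>Q\<^esub> q') = c q \<oplus>\<^bsub>J\<^esub> c q'"
      by (simp add: cp linear_homD(2)[OF pl])
  next
    fix k q assume k: "k \<in> carrier K" and "q \<in> carrier Q"
    then obtain v where v: "v \<in> carrier V" "q = p v" using lift by meson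
    have "c (p (k \<odot>\<^bsub>V\<^esub> v)) = k \<odot>\<^bsub>J\<^esub> h v"
      using v k by (simp add: cp linear_homD(3)[OF hl])
    with v k show "c (k \<odot>\<^bsub>Q\<^esub> q) = k \<odot>\<^bsub>J\<^esub> c q"
      by (simp add: cp linear_homD(3)[OF pl])
  next
    fix x q assume x: "x \<in> carrier D" and "q \<in> carrier Q"
    then obtain v where v: "v \<in> carrier V" "q = p v" using lift by meson
    have [simp]: "lam V x v \<in> carrier V" "rho V x v \<in> carrier V"
      using digroup_representation_operators[OF V x] v by (auto intro: linear_homD(1))
    have "c (p (lam V x v)) = lam J x (h v)" "c (p (rho V x v)) = rho J x (h v)"
      using v x by (simp_all add: cp rep_homD[OF h])
    with v x show "c (lam Q x q) = lam J x (c q)" "c (rho Q x q) = rho J x (c q)"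
      by (simp_all add: cp rep_homD[OF p])
  qed
  with cp that show thesis by blast
qed

text \<open>The universal property of a subobject: the compatibilities of the induced map can be checked
  after the injective \<open>\<eta>\<close>, where they are those of \<open>h\<close>.\<close>

lemma rep_hom_lift_through_inj:
  assumes W: "digroup_representation K D W"
    and \<eta>: "\<eta> \<in> rep_hom K D W J" and inj: "inj_on \<eta> (carrier W)"
    and V: "digroup_representation K D V"
    and h: "h \<in> rep_hom K D V J" and im: "h ` carrier V \<subseteq> \<eta> ` carrier W"
  obtains r where "r \<in> rep_hom K D V W" "\<And>v. v \<in> carrier V \<Longrightarrow> \<eta> (r v) = h v"
proof -
  interpret V: digroup_representation K D V by fact
  interpret W: digroup_representation K D W by fact
  note hl = rep_hom_linear[OF h] and \<eta>l = rep_hom_linear[OF \<eta>]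
  define r where "r = (\<lambda>v. inv_into (carrier W) \<eta> (h v))"
  have r: "r v \<in> carrier W" "\<eta> (r v) = h v" if "v \<in> carrier V" for v
    unfolding r_def using that im by (blast intro: inv_into_into f_inv_into_f)+
  have uniq: "r v = w" if "v \<in> carrier V" "w \<in> carrier W" "\<eta> w = h v" for v w
    using that r[of v] inj by (simp add: inj_on_def)
  have "r \<in> rep_hom K D V W"
    unfolding rep_hom_def linear_hom_def
  proof (intro CollectI conjI ballI Pi_I)
    fix x v assume x: "x \<in> carrier D" and v: "v \<in> carrier V"
    have [simp]: "lam V x v \<in> carrier V" "rho V x v \<in> carrier V"
      "lam W x (r v) \<in> carrier W" "rho W x (r v) \<in> carrier W"
      using digroup_representation_operators[OF V x] digroup_representation_operators[OF W x] v r(1)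
      by (auto intro: linear_homD(1))
    show "r (lam V x v) = lam W x (r v)" "r (rho V x v) = rho W x (r v)"
      using x v r by (auto intro!: uniq simp: rep_homD[OF h] rep_homD[OF \<eta>])
  qed (auto intro!: uniq simp: r linear_homD[OF hl] linear_homD[OF \<eta>l])
  with r that show thesis by blast
qed

text \<open>The morphism \<open>v \<mapsto> v - i (r v)\<close> of \<open>V\<close> vanishes on the image of \<open>i\<close>, which is the kernel of \<open>p\<close>, so it
  induces a morphism \<open>s : Q \<rightarrow> V\<close>. Since \<open>p\<close> does not see the correction \<open>i (r v)\<close>, this \<open>s\<close> is a section.\<close>

lemma splits_if_retraction:
  assumes ex: "short_exact K D W i V p Q"
    and r: "r \<in> rep_hom K D V W" and ri: "\<And>w. w \<in> carrier W \<Longrightarrow> r (i w) = w"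
  shows "splits K D V p Q"
proof -
  from ex have W: "digroup_representation K D W" and V: "digroup_representation K D V"
    and Q: "digroup_representation K D Q"
    and i: "i \<in> rep_hom K D W V" and p: "p \<in> rep_hom K D V Q"
    and ker: "i ` carrier W = a_kernel V Q p" and surj: "p ` carrier V = carrier Q"
    by (simp_all add: short_exact_def)
  interpret V: digroup_representation K D V by fact
  interpret Q: digroup_representation K D Q by fact
  note [simp] = linear_homD(1)[OF rep_hom_linear[OF r]] linear_homD(1)[OF rep_hom_linear[OF i]]
    linear_homD(1)[OF rep_hom_linear[OF p]]
  have id: "(\<lambda>v. v) \<in> rep_hom K D V V" by (auto simp: rep_hom_def linear_hom_def)
  define e where "e = (\<lambda>v. v \<ominus>\<^bsub>V\<^esub> i (r v))"
  have e: "e \<in> rep_hom K D V V"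
    unfolding e_def by (rule rep_hom_diff[OF V V id rep_hom_comp[OF r i]])
  have "e v = \<zero>\<^bsub>V\<^esub>" if v: "v \<in> a_kernel V Q p" for v
  proof -
    obtain w where "w \<in> carrier W" "v = i w" using v ker by blast
    then show ?thesis by (simp add: e_def ri a_minus_def V.M.r_neg)
  qed
  from rep_hom_factor_through_surj[OF V Q V p surj e this]
  obtain s where s: "s \<in> rep_hom K D Q V" "\<And>v. v \<in> carrier V \<Longrightarrow> s (p v) = e v" by blast
  have "p (s q) = q" if q: "q \<in> carrier Q" for q
  proof -
    obtain v where v: "v \<in> carrier V" "q = p v" using q surj by blast
    have "i (r v) \<in> a_kernel V Q p" using v ker by auto
    then have "p (i (r v)) = \<zero>\<^bsub>Q\<^esub>" by (simp add: a_kernel_def')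
    then have "p (e v) = p v"
      using v linear_hom_minus_apply[OF V.abelian_group_axioms Q.abelian_group_axioms
          rep_hom_linear[OF p], of v "i (r v)"]
      by (simp add: e_def a_minus_def)
    then show ?thesis using v s by simp
  qed
  with s(1) show ?thesis by (auto simp: splits_def)
qed


section \<open>Linear maps over the halo algebra\<close>

context action_representation
begin

lemma rho_group_linear:
  assumes "E \<noteq> {}" "g \<in> carrier G"
  shows "rho_group E V g \<in> linear_hom K V V"
proof -
  have "(SOME a. a \<in> E) \<in> E" using assms(1) by (simp add: some_in_eq)
  then show ?thesis
    unfolding rho_group_def using rho_Aut assms(2) by (simp add: action_digroup_def)
qed

lemma rho_group_closed:
  "\<lbrakk>E \<noteq> {}; g \<in> carrier G; v \<in> carrier V\<rbrakk> \<Longrightarrow> rho_group E V g v \<in> carrier V"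
  by (rule linear_homD(1)[OF rho_group_linear])

text \<open>The product \<open>(g, a) \<turnstile> (h, a)\<close> has second component \<open>g \<bullet> a\<close>, so the claim needs that \<open>rho\<close> depends
  on the group component only.\<close>

lemma rho_group_mult:
  assumes "E \<noteq> {}" "g \<in> carrier G" "h \<in> carrier G" "v \<in> carrier V"
  shows "rho_group E V (g \<otimes>\<^bsub>G\<^esub> h) v = rho_group E V g (rho_group E V h v)"
proof -
  interpret grp: group G using group_hom by (simp add: group_hom_def)
  obtain a where a: "a \<in> E" using assms(1) by blast
  have b: "\<phi> g a \<in> E" using element_image assms(2) a by blast
  have "rho_group E V (g \<otimes>\<^bsub>G\<^esub> h) v = rho V (g \<otimes>\<^bsub>G\<^esub> h, \<phi> g a) v"
    using b assms by (intro rho_group_eq) auto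
  also have "\<dots> = rho V (g, a) (rho V (h, a) v)"
    using rho_vdash[of "(g, a)" "(h, a)" v] a assms by (simp add: action_digroup_def)
  also have "\<dots> = rho_group E V g (rho_group E V h v)"
    using a assms rho_group_closed[of h v] by (simp add: rho_group_eq[where a = a])
  finally show ?thesis .
qed

lemma rho_group_one:
  assumes "E \<noteq> {}" "v \<in> carrier V"
  shows "rho_group E V \<one>\<^bsub>G\<^esub> v = v"
proof -
  obtain a where "a \<in> E" using assms(1) by blast
  then show ?thesis
    using assms(2) rho_halo[of "(\<one>\<^bsub>G\<^esub>, a)" v]
    by (simp add: rho_group_eq one_in_carrier action_digroup_def)
qed

lemma rho_group_inverse:
  assumes "E \<noteq> {}" "g \<in> carrier G" "v \<in> carrier V"
  shows "rho_group E V g (rho_group E V (inv\<^bsub>G\<^esub> g) v) = v"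
    and "rho_group E V (inv\<^bsub>G\<^esub> g) (rho_group E V g v) = v"
proof -
  interpret grp: group G using group_hom by (simp add: group_hom_def)
  show "rho_group E V g (rho_group E V (inv\<^bsub>G\<^esub> g) v) = v"
    "rho_group E V (inv\<^bsub>G\<^esub> g) (rho_group E V g v) = v"
    using assms by (simp_all add: rho_group_mult[symmetric] rho_group_one)
qed

lemma inv_into_rho_group:
  assumes "E \<noteq> {}" "g \<in> carrier G" "v \<in> carrier V"
  shows "inv_into (carrier V) (rho_group E V g) v = rho_group E V (inv\<^bsub>G\<^esub> g) v"
proof (rule inv_into_f_eq)
  interpret grp: group G using group_hom by (simp add: group_hom_def)
  show "inj_on (rho_group E V g) (carrier V)"
    by (rule inj_on_inverseI[where g = "rho_group E V (inv\<^bsub>G\<^esub> g)"])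
       (rule rho_group_inverse(2)[OF assms(1,2)])
  show "rho_group E V (inv\<^bsub>G\<^esub> g) v \<in> carrier V"
    using assms by (simp add: rho_group_closed)
  show "rho_group E V g (rho_group E V (inv\<^bsub>G\<^esub> g) v) = v"
    by (rule rho_group_inverse(1)[OF assms])
qed

lemma lam_one_closed:
  "\<lbrakk>a \<in> E; v \<in> carrier V\<rbrakk> \<Longrightarrow> lam V (\<one>\<^bsub>G\<^esub>, a) v \<in> carrier V"
  by (rule linear_homD(1)[OF lam_one_linear])

text \<open>Since \<open>(g, a) = (1, a) \<stileturn> (g, a)\<close>, the left operators of a representation are determined by the
  generators of the halo algebra and by the group representation.\<close>

lemma lam_eq_lam_one_rho_group:
  assumes "g \<in> carrier G" "a \<in> E" "v \<in> carrier V"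
  shows "lam V (g, a) v = lam V (\<one>\<^bsub>G\<^esub>, a) (rho_group E V g v)"
proof -
  interpret grp: group G using group_hom by (simp add: group_hom_def)
  show ?thesis
    using lam_rho[of "(\<one>\<^bsub>G\<^esub>, a)" "(g, a)" v] assms
    by (simp add: action_digroup_def rho_group_eq)
qed

text \<open>Conjugation by \<open>rho g\<close> permutes the generators of the halo algebra as \<open>g\<close> permutes \<open>E\<close>, because
  \<open>(g, a) \<turnstile> (1, a) = (g, g \<bullet> a)\<close>. This is why \<open>G\<close> acts on the maps that are linear over the halo
  algebra.\<close>

lemma rho_group_lam_one:
  assumes "g \<in> carrier G" "a \<in> E" "v \<in> carrier V"
  shows "rho_group E V g (lam V (\<one>\<^bsub>G\<^esub>, a) v) = lam V (\<one>\<^bsub>G\<^esub>, \<phi> g a) (rho_group E V g v)"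
proof -
  interpret grp: group G using group_hom by (simp add: group_hom_def)
  have b: "\<phi> g a \<in> E" using element_image assms by blast
  have "rho_group E V g (lam V (\<one>\<^bsub>G\<^esub>, a) v) = rho V (g, a) (lam V (\<one>\<^bsub>G\<^esub>, a) v)"
    using assms by (intro rho_group_eq) (auto intro: lam_one_closed)
  also have "\<dots> = lam V (g, \<phi> g a) v"
    using rho_lam[of "(g, a)" "(\<one>\<^bsub>G\<^esub>, a)" v] assms by (simp add: action_digroup_def)
  finally show ?thesis using b assms by (simp add: lam_eq_lam_one_rho_group)
qed

end

locale action_representation_pair =
    Q: action_representation G E \<phi> K Q + J: action_representation G E \<phi> K J
  for G :: "('g, 'n) monoid_scheme" (structure) and E :: "'e set" and \<phi>
    and K :: "('k, 'm) ring_scheme" (structure)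
    and Q :: "('k, 'g \<times> 'e, 'q) digroup_rep" and J :: "('k, 'g \<times> 'e, 'v) digroup_rep" +
  assumes E_nonempty: "E \<noteq> {}"
begin

sublocale grp: group G
  using Q.group_hom by (simp add: group_hom_def)

abbreviation "halo_Hom \<equiv> linear_hom (halo_algebra K E) (halo_module G Q) (halo_module G J)"

text \<open>Linearity over an algebra need only be tested on scalars and generators, which replaces the
  quotient of the term algebra by conditions on the operators.\<close>

lemma halo_Hom_iff:
  "f \<in> halo_Hom \<longleftrightarrow> f \<in> linear_hom K Q J \<and>
    (\<forall>a\<in>E. \<forall>q\<in>carrier Q. f (lam Q (\<one>, a) q) = lam J (\<one>, a) (f q))"
    (is "?halo \<longleftrightarrow> ?lin \<and> ?gen")
proof
  assume f: ?halo
  have eval: "f (halo_eval G Q t q) = halo_eval G J t (f q)"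
    if "t \<in> halo_terms K E" "q \<in> carrier Q" for t q
    using linear_homD(3)[OF f, of "halo_class K E t" q] linear_homD(1)[OF f, of q] that
    by (simp add: halo_algebra_carrier Q.halo_module_smult J.halo_module_smult)
       (simp add: halo_module_def Q.halo_module_smult[symmetric] J.halo_module_smult[symmetric])
  show "?lin \<and> ?gen"
    using linear_homD(1,2)[OF f] eval[OF halo_terms.Scal] eval[OF halo_terms.Gen]
    by (auto simp: linear_hom_def halo_module_def)
next
  assume asm: "?lin \<and> ?gen"
  then have lin: ?lin and gen: ?gen by auto
  have "f (halo_eval G Q t q) = halo_eval G J t (f q)"
    if "t \<in> halo_terms K E" "q \<in> carrier Q" for t q
    using that
  proof (induction arbitrary: q)
    case (Plus s t)
    then show ?case by (simp add: linear_homD(2)[OF lin] Q.halo_eval_closed)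
  next
    case (Times s t)
    then show ?case by (simp add: Q.halo_eval_closed)
  qed (use gen in \<open>simp_all add: linear_homD(3)[OF lin]\<close>)
  moreover have "carrier (halo_module G Q) = carrier Q" "carrier (halo_module G J) = carrier J"
    "add (halo_module G Q) = add Q" "add (halo_module G J) = add J"
    by (simp_all add: halo_module_def)
  ultimately show ?halo
    using linear_homD(1,2)[OF lin]
    by (auto simp: linear_hom_def[of "halo_algebra K E"] halo_algebra_carrier
        Q.halo_module_smult J.halo_module_smult)
qed

lemma halo_HomD:
  assumes "f \<in> halo_Hom"
  shows "f \<in> linear_hom K Q J"
    and "q \<in> carrier Q \<Longrightarrow> f q \<in> carrier J"
    and "\<lbrakk>a \<in> E; q \<in> carrier Q\<rbrakk> \<Longrightarrow> f (lam Q (\<one>, a) q) = lam J (\<one>, a) (f q)"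
  using assms by (auto simp: halo_Hom_iff intro: linear_homD(1))

lemma restrict_halo_Hom:
  assumes "f \<in> halo_Hom"
  shows "restrict f (carrier Q) \<in> halo_Hom"
  using halo_HomD[OF assms] linear_homD[OF halo_HomD(1)[OF assms]]
  unfolding halo_Hom_iff by (auto simp: linear_hom_def Q.lam_one_closed)

text \<open>By \<open>lam_eq_lam_one_rho_group\<close>, the missing compatibility of a map that is linear over the halo
  algebra is equivariance.\<close>

lemma rep_hom_iff:
  "f \<in> rep_hom K (action_digroup G E \<phi>) Q J \<longleftrightarrow> f \<in> halo_Hom \<and>
    (\<forall>g\<in>carrier G. \<forall>q\<in>carrier Q. f (rho_group E Q g q) = rho_group E J g (f q))"
proof
  assume f: "f \<in> rep_hom K (action_digroup G E \<phi>) Q J"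
  obtain a where a: "a \<in> E" using E_nonempty by blast
  from f have lin: "f \<in> linear_hom K Q J" by (rule rep_hom_linear)
  have "f \<in> halo_Hom"
    using lin rep_homD(1)[OF f] by (simp add: halo_Hom_iff action_digroup_def)
  moreover have "f (rho_group E Q g q) = rho_group E J g (f q)"
    if "g \<in> carrier G" "q \<in> carrier Q" for g q
    using that a rep_homD(2)[OF f, of "(g, a)"] linear_homD(1)[OF lin]
    by (simp add: Q.rho_group_eq J.rho_group_eq action_digroup_def)
  ultimately show "f \<in> halo_Hom \<and>
      (\<forall>g\<in>carrier G. \<forall>q\<in>carrier Q. f (rho_group E Q g q) = rho_group E J g (f q))"
    by blast
next
  assume asm: "f \<in> halo_Hom \<and>
    (\<forall>g\<in>carrier G. \<forall>q\<in>carrier Q. f (rho_group E Q g q) = rho_group E J g (f q))"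
  then have f: "f \<in> halo_Hom"
    and equi: "\<And>g q. \<lbrakk>g \<in> carrier G; q \<in> carrier Q\<rbrakk> \<Longrightarrow>
      f (rho_group E Q g q) = rho_group E J g (f q)" by auto
  have "f (lam Q (g, a) q) = lam J (g, a) (f q)" "f (rho Q (g, a) q) = rho J (g, a) (f q)"
    if g: "g \<in> carrier G" and a: "a \<in> E" and q: "q \<in> carrier Q" for g a q
  proof -
    show "f (lam Q (g, a) q) = lam J (g, a) (f q)"
      unfolding Q.lam_eq_lam_one_rho_group[OF g a q]
        J.lam_eq_lam_one_rho_group[OF g a halo_HomD(2)[OF f q]] equi[OF g q, symmetric]
      by (rule halo_HomD(3)[OF f a Q.rho_group_closed[OF E_nonempty g q]])
    show "f (rho Q (g, a) q) = rho J (g, a) (f q)"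
      using equi[OF g q] Q.rho_group_eq[OF g a q] J.rho_group_eq[OF g a halo_HomD(2)[OF f q]]
      by simp
  qed
  with halo_HomD(1)[OF f] show "f \<in> rep_hom K (action_digroup G E \<phi>) Q J"
    by (auto simp: rep_hom_def action_digroup_def)
qed

section \<open>The group action on linear maps over the halo algebra\<close>

lemma hom_act_apply:
  assumes "g \<in> carrier G" "q \<in> carrier Q"
  shows "hom_act E Q J g f q = rho_group E J g (f (rho_group E Q (inv g) q))"
  using assms by (simp add: hom_act_def Q.inv_into_rho_group[OF E_nonempty])

text \<open>Moving the generator of \<open>a\<close> past \<open>rho (inv g)\<close> turns it into the generator of \<open>b = inv g \<bullet> a\<close>; it
  passes through \<open>f\<close>, and \<open>rho g\<close> turns it back into the generator of \<open>a\<close>.\<close>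

lemma hom_act_halo_Hom:
  assumes g: "g \<in> carrier G" and f: "f \<in> halo_Hom"
  shows "hom_act E Q J g f \<in> halo_Hom"
  unfolding halo_Hom_iff
proof (intro conjI ballI)
  note rg = linear_homD[OF J.rho_group_linear[OF E_nonempty g]]
    linear_homD[OF Q.rho_group_linear[OF E_nonempty grp.inv_closed[OF g]]]
    linear_homD[OF halo_HomD(1)[OF f]]
  then show "hom_act E Q J g f \<in> linear_hom K Q J"
    using g by (simp add: linear_hom_def Pi_iff hom_act_apply)
  fix a q assume a: "a \<in> E" and q: "q \<in> carrier Q"
  define b where "b = \<phi> (inv g) a"
  have b: "b \<in> E" "\<phi> g b = a"
    using a g Q.element_image[of "inv g" a] Q.orbit_sym_aux[of "inv g" a b] by (auto simp: b_def)
  have "hom_act E Q J g f (lam Q (\<one>, a) q)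
      = rho_group E J g (f (lam Q (\<one>, b) (rho_group E Q (inv g) q)))"
    using a g q by (simp add: hom_act_apply Q.lam_one_closed Q.rho_group_lam_one b_def)
  also have "\<dots> = lam J (\<one>, a) (rho_group E J g (f (rho_group E Q (inv g) q)))"
    using b g q by (simp add: halo_HomD[OF f] J.rho_group_lam_one rg)
  finally show "hom_act E Q J g f (lam Q (\<one>, a) q) = lam J (\<one>, a) (hom_act E Q J g f q)"
    using g q by (simp add: hom_act_apply)
qed

lemma hom_act_rep_hom:
  assumes "f \<in> rep_hom K (action_digroup G E \<phi>) Q J" "g \<in> carrier G" "q \<in> carrier Q"
  shows "hom_act E Q J g f q = f q"
  using assms by (simp add: hom_act_apply rep_hom_iff halo_HomD(2) J.rho_group_inverse[OF E_nonempty])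

lemma hom_act_inv_cancel:
  assumes g: "g \<in> carrier G" and x: "x \<in> carrier Q \<rightarrow>\<^sub>E carrier J"
  shows "hom_act E Q J g (hom_act E Q J (inv g) x) = x"
proof
  fix q
  show "hom_act E Q J g (hom_act E Q J (inv g) x) q = x q"
  proof (cases "q \<in> carrier Q")
    case True
    then show ?thesis
      using g PiE_mem[OF x, of q]
      by (simp add: hom_act_apply Q.rho_group_closed[OF E_nonempty]
          Q.rho_group_inverse[OF E_nonempty] J.rho_group_inverse[OF E_nonempty])
  next
    case False
    then show ?thesis using PiE_arb[OF x False] by (simp add: hom_act_def)
  qed
qed

text \<open>Invariance of a cohomology class is an equality of sets of cocycles. As \<open>inv g\<close> acts as well, one
  inclusion for every group element is enough.\<close>

lemma hom_act_image_eqI: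
  assumes C: "C \<subseteq> carrier Q \<rightarrow>\<^sub>E carrier J"
    and sub: "\<And>g. g \<in> carrier G \<Longrightarrow> hom_act E Q J g ` C \<subseteq> C"
    and g: "g \<in> carrier G"
  shows "hom_act E Q J g ` C = C"
proof
  show "C \<subseteq> hom_act E Q J g ` C"
  proof
    fix x assume x: "x \<in> C"
    then have "hom_act E Q J (inv g) x \<in> C" using sub[of "inv g"] g by blast
    moreover have "x = hom_act E Q J g (hom_act E Q J (inv g) x)"
      using hom_act_inv_cancel[OF g, of x] x C by auto
    ultimately show "x \<in> hom_act E Q J g ` C" by blast
  qed
qed (rule sub[OF g])

end

section \<open>Averaging over a finite group\<close>

locale averaging = action_representation_pair +
  assumes finite_group: "finite (carrier G)"
    and card_nonzero: "[card (carrier G)] \<cdot>\<^bsub>K\<^esub> \<one>\<^bsub>K\<^esub> \<noteq> \<zero>\<^bsub>K\<^esub>"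
begin

definition average where
  "average f q = inv\<^bsub>K\<^esub> ([card (carrier G)] \<cdot>\<^bsub>K\<^esub> \<one>\<^bsub>K\<^esub>) \<odot>\<^bsub>J\<^esub>
    (\<Oplus>\<^bsub>J\<^esub>g\<in>carrier G. hom_act E Q J g f q)"

lemma card_inverse:
  "inv\<^bsub>K\<^esub> ([card (carrier G)] \<cdot>\<^bsub>K\<^esub> \<one>\<^bsub>K\<^esub>) \<in> carrier K"
  "inv\<^bsub>K\<^esub> ([card (carrier G)] \<cdot>\<^bsub>K\<^esub> \<one>\<^bsub>K\<^esub>) \<otimes>\<^bsub>K\<^esub> ([card (carrier G)] \<cdot>\<^bsub>K\<^esub> \<one>\<^bsub>K\<^esub>) = \<one>\<^bsub>K\<^esub>"
proof -
  have "[card (carrier G)] \<cdot>\<^bsub>K\<^esub> \<one>\<^bsub>K\<^esub> \<in> Units K"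
    using card_nonzero by (simp add: Q.K.field_Units)
  then show "inv\<^bsub>K\<^esub> ([card (carrier G)] \<cdot>\<^bsub>K\<^esub> \<one>\<^bsub>K\<^esub>) \<in> carrier K"
    "inv\<^bsub>K\<^esub> ([card (carrier G)] \<cdot>\<^bsub>K\<^esub> \<one>\<^bsub>K\<^esub>) \<otimes>\<^bsub>K\<^esub> ([card (carrier G)] \<cdot>\<^bsub>K\<^esub> \<one>\<^bsub>K\<^esub>) = \<one>\<^bsub>K\<^esub>"
    by simp_all
qed

text \<open>The translates of \<open>f\<close> are linear over the halo algebra, and so are their sums and scalar
  multiples, the latter because scalars are central.\<close>

lemma average_in_halo_Hom:
  assumes f: "f \<in> halo_Hom"
  shows "average f \<in> halo_Hom"
  unfolding halo_Hom_iff
proof (intro conjI ballI)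
  note act = hom_act_halo_Hom[OF _ f]
  note [simp] = linear_homD[OF halo_HomD(1)[OF act]] card_inverse J.M.finsum_closed
  have pi: "(\<lambda>g. hom_act E Q J g f q) \<in> carrier G \<rightarrow> carrier J" if "q \<in> carrier Q" for q
    using that by simp
  show "average f \<in> linear_hom K Q J"
    unfolding linear_hom_def
  proof (intro CollectI conjI ballI Pi_I)
    fix q assume q: "q \<in> carrier Q"
    then show "average f q \<in> carrier J" by (simp add: average_def pi)
    fix q' assume q': "q' \<in> carrier Q"
    have "(\<Oplus>\<^bsub>J\<^esub>g\<in>carrier G. hom_act E Q J g f (q \<oplus>\<^bsub>Q\<^esub> q'))
        = (\<Oplus>\<^bsub>J\<^esub>g\<in>carrier G. hom_act E Q J g f q \<oplus>\<^bsub>J\<^esub> hom_act E Q J g f q')"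
      using q q' by (intro J.M.finsum_cong') auto
    also have "\<dots> = (\<Oplus>\<^bsub>J\<^esub>g\<in>carrier G. hom_act E Q J g f q) \<oplus>\<^bsub>J\<^esub> (\<Oplus>\<^bsub>J\<^esub>g\<in>carrier G. hom_act E Q J g f q')"
      using q q' by (intro J.M.finsum_addf pi)
    finally show "average f (q \<oplus>\<^bsub>Q\<^esub> q') = average f q \<oplus>\<^bsub>J\<^esub> average f q'"
      using q q' by (simp add: average_def pi J.smult_r_distr)
  next
    fix k q assume k: "k \<in> carrier K" and q: "q \<in> carrier Q"
    have "(\<Oplus>\<^bsub>J\<^esub>g\<in>carrier G. hom_act E Q J g f (k \<odot>\<^bsub>Q\<^esub> q))
        = (\<Oplus>\<^bsub>J\<^esub>g\<in>carrier G. k \<odot>\<^bsub>J\<^esub> hom_act E Q J g f q)"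
      using k q by (intro J.M.finsum_cong') auto
    also have "\<dots> = k \<odot>\<^bsub>J\<^esub> (\<Oplus>\<^bsub>J\<^esub>g\<in>carrier G. hom_act E Q J g f q)"
      using k q finite_group by (intro J.finsum_smult_ldistr[symmetric] pi)
    finally show "average f (k \<odot>\<^bsub>Q\<^esub> q) = k \<odot>\<^bsub>J\<^esub> average f q"
      using k q by (simp add: average_def pi Q.K.m_comm flip: J.smult_assoc1)
  qed
  fix a q assume a: "a \<in> E" and q: "q \<in> carrier Q"
  note lam = J.lam_one_linear[OF a]
  have "(\<Oplus>\<^bsub>J\<^esub>g\<in>carrier G. hom_act E Q J g f (lam Q (\<one>, a) q))
      = (\<Oplus>\<^bsub>J\<^esub>g\<in>carrier G. lam J (\<one>, a) (hom_act E Q J g f q))"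
    using a q by (intro J.M.finsum_cong') (auto simp: halo_HomD(3)[OF act] J.lam_one_closed)
  also have "\<dots> = lam J (\<one>, a) (\<Oplus>\<^bsub>J\<^esub>g\<in>carrier G. hom_act E Q J g f q)"
    by (rule linear_hom_finsum[OF J.abelian_group_axioms J.abelian_group_axioms lam pi[OF q], symmetric])
  finally show "average f (lam Q (\<one>, a) q) = lam J (\<one>, a) (average f q)"
    using q by (simp add: average_def pi linear_homD(3)[OF lam])
qed

text \<open>Maschke's argument: \<open>rho h\<close> carries the translate of \<open>f\<close> by \<open>g\<close> to the one by \<open>h g\<close> (fact \<open>shift\<close>),
  and \<open>g \<mapsto> h g\<close> only reorders the sum.\<close>

lemma average_rep_hom:
  assumes f: "f \<in> halo_Hom"
  shows "average f \<in> rep_hom K (action_digroup G E \<phi>) Q J"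
  unfolding rep_hom_iff
proof (intro conjI ballI average_in_halo_Hom[OF f])
  note act = hom_act_halo_Hom[OF _ f]
  note Qc = Q.rho_group_closed[OF E_nonempty] and Jc = J.rho_group_closed[OF E_nonempty]
  fix h q assume h: "h \<in> carrier G" and q: "q \<in> carrier Q"
  note lin = J.rho_group_linear[OF E_nonempty h]
  have pi: "(\<lambda>g. hom_act E Q J g f q) \<in> carrier G \<rightarrow> carrier J" if "q \<in> carrier Q" for q
    using that by (auto intro: halo_HomD(2)[OF act])
  have shift: "rho_group E J h (hom_act E Q J g f q) = hom_act E Q J (h \<otimes> g) f (rho_group E Q h q)"
    if g: "g \<in> carrier G" for g
  proof -
    have "rho_group E Q (inv (h \<otimes> g)) (rho_group E Q h q) = rho_group E Q (inv (h \<otimes> g) \<otimes> h) q"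
      using g h q by (simp add: Q.rho_group_mult[OF E_nonempty])
    also have "inv (h \<otimes> g) \<otimes> h = inv g"
      using g h by (simp add: grp.inv_mult_group grp.m_assoc)
    finally show ?thesis
      using g h q
      by (simp add: hom_act_apply Qc J.rho_group_mult[OF E_nonempty] halo_HomD(2)[OF f])
  qed
  have "rho_group E J h (\<Oplus>\<^bsub>J\<^esub>g\<in>carrier G. hom_act E Q J g f q)
      = (\<Oplus>\<^bsub>J\<^esub>g\<in>carrier G. rho_group E J h (hom_act E Q J g f q))"
    by (rule linear_hom_finsum[OF J.abelian_group_axioms J.abelian_group_axioms lin pi[OF q]])
  also have "\<dots> = (\<Oplus>\<^bsub>J\<^esub>g\<in>carrier G. hom_act E Q J (h \<otimes> g) f (rho_group E Q h q))"
    using h q by (intro J.M.finsum_cong') (auto simp: shift intro!: halo_HomD(2)[OF act] Qc)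
  also have "\<dots> = (\<Oplus>\<^bsub>J\<^esub>g\<in>(\<lambda>g. h \<otimes> g) ` carrier G. hom_act E Q J g f (rho_group E Q h q))"
    using h q by (intro J.M.finsum_reindex[symmetric])
      (auto intro!: halo_HomD(2)[OF act] Qc grp.inj_on_cmult)
  also have "(\<lambda>g. h \<otimes> g) ` carrier G = carrier G"
    by (rule grp.surj_const_mult[OF h])
  finally show "average f (rho_group E Q h q) = rho_group E J h (average f q)"
    using q by (simp add: average_def pi linear_homD(3)[OF lin] card_inverse J.M.finsum_closed)
qed

text \<open>Composing with the equivariant \<open>d\<close> commutes with translation, so \<open>d\<close> maps every translate of \<open>f\<close> to
  the corresponding translate of \<open>c\<close>, which is \<open>c\<close> itself. The mean of copies of \<open>c q\<close> is \<open>c q\<close>.\<close>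

lemma average_lifts_rep_hom:
  assumes J': "action_representation G E \<phi> K J'"
    and d: "d \<in> rep_hom K (action_digroup G E \<phi>) J J'"
    and c: "c \<in> rep_hom K (action_digroup G E \<phi>) Q J'"
    and f: "f \<in> halo_Hom" and df: "\<And>q. q \<in> carrier Q \<Longrightarrow> d (f q) = c q"
    and q: "q \<in> carrier Q"
  shows "d (average f q) = c q"
proof -
  interpret J': action_representation G E \<phi> K J' by fact
  interpret QJ': action_representation_pair G E \<phi> K Q J' by unfold_locales (rule E_nonempty)
  interpret JJ': action_representation_pair G E \<phi> K J J' by unfold_locales (rule E_nonempty)
  note dl = rep_hom_linear[OF d]
  note Qc = Q.rho_group_closed[OF E_nonempty]
  have cq: "c q \<in> carrier J'" using linear_homD(1)[OF rep_hom_linear[OF c]] q .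
  have act: "(\<lambda>g. hom_act E Q J g f q) \<in> carrier G \<rightarrow> carrier J"
    using q by (auto intro: halo_HomD(2)[OF hom_act_halo_Hom[OF _ f]])
  have d_act: "d (hom_act E Q J g f q) = c q" if g: "g \<in> carrier G" for g
  proof -
    have "d (hom_act E Q J g f q) = hom_act E Q J' g c q"
      using g q d df by (simp add: hom_act_apply QJ'.hom_act_apply JJ'.rep_hom_iff Qc halo_HomD(2)[OF f])
    then show ?thesis using QJ'.hom_act_rep_hom[OF c g q] by simp
  qed
  have "d (\<Oplus>\<^bsub>J\<^esub>g\<in>carrier G. hom_act E Q J g f q) = (\<Oplus>\<^bsub>J'\<^esub>g\<in>carrier G. d (hom_act E Q J g f q))"
    by (rule linear_hom_finsum[OF J.abelian_group_axioms J'.abelian_group_axioms dl act])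
  also have "\<dots> = (\<Oplus>\<^bsub>J'\<^esub>g\<in>carrier G. c q)"
    using cq by (intro J'.M.finsum_cong') (auto simp: d_act)
  also have "\<dots> = ([card (carrier G)] \<cdot>\<^bsub>K\<^esub> \<one>\<^bsub>K\<^esub>) \<odot>\<^bsub>J'\<^esub> c q"
    by (rule J'.finsum_const_smult[OF cq])
  finally show ?thesis
    using cq act
    by (simp add: average_def linear_homD(3)[OF dl] card_inverse J.M.finsum_closed
        flip: J'.smult_assoc1)
qed

end

section \<open>Equivariant cocycles and the first Ext group\<close>

text \<open>If \<open>c\<close> is equivariant, then \<open>g\<close> maps a cocycle \<open>d 0 \<circ> f + c\<close> of its class to
  \<open>d 0 \<circ> (g \<cdot> f) + c\<close>, which lies in the same class. The class is thus invariant, so it is the zero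
  class, that is, the set of coboundaries, and \<open>c\<close> is one of its members.\<close>

lemma equivariant_cocycle_is_coboundary:
  fixes K :: "('k, 'm) ring_scheme" and G :: "('g, 'n) monoid_scheme" and E :: "'e set"
    and Q :: "('k, 'g \<times> 'e, 'u) digroup_rep"
    and I :: "nat \<Rightarrow> ('k, 'g \<times> 'e, 'u) digroup_rep"
  assumes reps: "action_representation G E \<phi> K Q" "\<And>n. action_representation G E \<phi> K (I n)"
    and E: "E \<noteq> {}"
    and d: "\<And>n. d n \<in> rep_hom K (action_digroup G E \<phi>) (I n) (I (n + 1))"
    and c: "c \<in> rep_hom K (action_digroup G E \<phi>) Q (I 1)"
    and cocycle: "\<And>q. q \<in> carrier Q \<Longrightarrow> d 1 (c q) = \<zero>\<^bsub>I 2\<^esub>"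
    and ext: "halo_Ext1_invariants K G E Q I d = {\<one>\<^bsub>halo_Ext1 K G E Q I d\<^esub>}"
  obtains f where "f \<in> linear_hom (halo_algebra K E) (halo_module G Q) (halo_module G (I 0))"
    and "\<And>q. q \<in> carrier Q \<Longrightarrow> d 0 (f q) = c q"
proof -
  \<comment> \<open>Keeps the terms \<open>I 1\<close> and \<open>d 1\<close> from being rewritten to \<open>Suc 0\<close>.\<close>
  note [simp del] = One_nat_def
  have pair: "action_representation_pair G E \<phi> K Q (I n)" for n
    using reps E by (simp add: action_representation_pair_def action_representation_pair_axioms_def)
  have pairI: "action_representation_pair G E \<phi> K (I 0) (I 1)"
    using reps E by (simp add: action_representation_pair_def action_representation_pair_axioms_def)
  interpret Q0: action_representation_pair G E \<phi> K Q "I 0" by (rule pair)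
  interpret Q1: action_representation_pair G E \<phi> K Q "I 1" by (rule pair)
  interpret I01: action_representation_pair G E \<phi> K "I 0" "I 1" by (rule pairI)
  have d0: "d 0 \<in> rep_hom K (action_digroup G E \<phi>) (I 0) (I 1)" using d[of 0] by simp
  have mod: "carrier (halo_module G V) = carrier V" "add (halo_module G V) = add V"
    "zero (halo_module G V) = zero V" for V :: "('k, 'g \<times> 'e, 'u) digroup_rep"
    by (simp_all add: halo_module_def)
  define H where "H = compose (carrier Q) (d 0) ` (Q0.halo_Hom \<inter> extensional (carrier Q))"
  \<comment> \<open>Members of the Hom groups are extensional, but \<open>c\<close> is arbitrary off the carrier of \<open>Q\<close>.\<close>
  define c' where "c' = restrict c (carrier Q)"
  \<comment> \<open>The class of \<open>c\<close>, a coset of the coboundaries \<open>H\<close>.\<close>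
  define C where "C = (\<lambda>b. \<lambda>q\<in>carrier Q. b q \<oplus>\<^bsub>I 1\<^esub> c' q) ` H"
  have c1: "c \<in> Q1.halo_Hom" using c unfolding Q1.rep_hom_iff by blast
  then have c'1: "c' \<in> Q1.halo_Hom" unfolding c'_def by (rule Q1.restrict_halo_Hom)
  have c'_ext: "c' \<in> extensional (carrier Q)" by (simp add: c'_def)
  have c'_apply: "c' q = c q" if "q \<in> carrier Q" for q using that by (simp add: c'_def)
  have C_class: "C \<in> carrier (halo_Ext1 K G E Q I d)"
    unfolding halo_Ext1_def Ext1_def carrier_FactGroup
  proof (rule image_eqI)
    show "C = (compose (carrier (halo_module G Q)) (d 0) `
        carrier (Hom_group (halo_algebra K E) (halo_module G Q) (halo_module G (I 0))))
      #>\<^bsub>Hom_group (halo_algebra K E) (halo_module G Q) (halo_module G (I 1))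
      \<lparr>carrier := kernel (Hom_group (halo_algebra K E) (halo_module G Q) (halo_module G (I 1)))
        (Hom_group (halo_algebra K E) (halo_module G Q) (halo_module G (I 2)))
        (compose (carrier (halo_module G Q)) (d 1))\<rparr>\<^esub> c'"
      by (auto simp: C_def H_def r_coset_def Hom_group_def mod)
    show "c' \<in> carrier (Hom_group (halo_algebra K E) (halo_module G Q) (halo_module G (I 1))
      \<lparr>carrier := kernel (Hom_group (halo_algebra K E) (halo_module G Q) (halo_module G (I 1)))
        (Hom_group (halo_algebra K E) (halo_module G Q) (halo_module G (I 2)))
        (compose (carrier (halo_module G Q)) (d 1))\<rparr>)"
      using c'1 c'_ext by (auto simp: kernel_def Hom_group_def mod compose_def cocycle c'_apply)
  qed
  have H_one: "\<one>\<^bsub>halo_Ext1 K G E Q I d\<^esub> = H"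
    by (simp add: halo_Ext1_def Ext1_def H_def Hom_group_def mod)
  have "C \<in> halo_Ext1_invariants K G E Q I d"
    unfolding halo_Ext1_invariants_def
  proof (intro CollectI conjI ballI C_class, rule Q1.hom_act_image_eqI)
    note d0l = linear_homD[OF rep_hom_linear[OF d0]]
    show "C \<subseteq> carrier Q \<rightarrow>\<^sub>E carrier (I 1)"
      by (auto simp: C_def H_def compose_def Q0.halo_HomD(2) Q1.halo_HomD(2)[OF c'1] d0l(1))
    fix g assume g: "g \<in> carrier G"
    note lin = linear_homD[OF Q1.J.rho_group_linear[OF E g]]
    show "hom_act E Q (I 1) g ` C \<subseteq> C"
    proof
      fix x assume "x \<in> hom_act E Q (I 1) g ` C"
      then obtain f where f: "f \<in> Q0.halo_Hom" "f \<in> extensional (carrier Q)"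
        and x: "x = hom_act E Q (I 1) g (\<lambda>q\<in>carrier Q. compose (carrier Q) (d 0) f q \<oplus>\<^bsub>I 1\<^esub> c' q)"
        by (auto simp: C_def H_def)
      define f' where "f' = hom_act E Q (I 0) g f"
      have "f' \<in> Q0.halo_Hom \<inter> extensional (carrier Q)"
        using Q0.hom_act_halo_Hom[OF g f(1)] by (simp add: f'_def hom_act_def)
      moreover have "x = (\<lambda>q\<in>carrier Q. compose (carrier Q) (d 0) f' q \<oplus>\<^bsub>I 1\<^esub> c' q)"
      proof
        fix q
        show "x q = (\<lambda>q\<in>carrier Q. compose (carrier Q) (d 0) f' q \<oplus>\<^bsub>I 1\<^esub> c' q) q"
        proof (cases "q \<in> carrier Q")
          case True
          define q' where "q' = rho_group E Q (inv\<^bsub>G\<^esub> g) q"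
          have q': "q' \<in> carrier Q"
            using True g by (simp add: q'_def Q0.Q.rho_group_closed[OF E])
          have fq: "f q' \<in> carrier (I 0)" using Q0.halo_HomD(2)[OF f(1) q'] .
          have "x q = rho_group E (I 1) g (d 0 (f q') \<oplus>\<^bsub>I 1\<^esub> c q')"
            using True g q' by (simp add: x Q1.hom_act_apply compose_def c'_apply flip: q'_def)
          also have "\<dots> = rho_group E (I 1) g (d 0 (f q')) \<oplus>\<^bsub>I 1\<^esub> rho_group E (I 1) g (c q')"
            using fq q' by (intro lin(2) d0l(1) Q1.halo_HomD(2)[OF c1])
          also have "rho_group E (I 1) g (d 0 (f q')) = d 0 (rho_group E (I 0) g (f q'))"
            using d0 g fq by (simp add: I01.rep_hom_iff)
          also have "rho_group E (I 0) g (f q') = f' q"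
            using g True by (simp add: f'_def q'_def Q0.hom_act_apply)
          also have "rho_group E (I 1) g (c q') = c q"
            using Q1.hom_act_rep_hom[OF c g True] by (simp add: Q1.hom_act_apply[OF g True] q'_def)
          finally show ?thesis using True by (simp add: compose_def c'_apply)
        qed (simp add: x hom_act_def)
      qed
      ultimately show "x \<in> C" unfolding C_def H_def by blast
    qed
  qed
  then have "C = H" using ext H_one by simp
  \<comment> \<open>Add the coboundary \<open>0\<close>.\<close>
  have "c' \<in> C"
  proof -
    have "lam (I 0) (\<one>\<^bsub>G\<^esub>, a) \<zero>\<^bsub>I 0\<^esub> = \<zero>\<^bsub>I 0\<^esub>" if "a \<in> E" for a
      using linear_hom_abelian_group_hom[OF Q0.J.abelian_group_axioms Q0.J.abelian_group_axioms
          Q0.J.lam_one_linear[OF that]]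
      by (rule abelian_group_hom.hom_zero)
    then have z: "(\<lambda>q\<in>carrier Q. \<zero>\<^bsub>I 0\<^esub>) \<in> Q0.halo_Hom"
      unfolding Q0.halo_Hom_iff by (auto simp: linear_hom_def Q0.Q.lam_one_closed)
    have "d 0 \<zero>\<^bsub>I 0\<^esub> = \<zero>\<^bsub>I 1\<^esub>"
      using linear_hom_abelian_group_hom[OF Q0.J.abelian_group_axioms Q1.J.abelian_group_axioms rep_hom_linear[OF d0]]
      by (rule abelian_group_hom.hom_zero)
    then have "c' = (\<lambda>q\<in>carrier Q. compose (carrier Q) (d 0) (\<lambda>q\<in>carrier Q. \<zero>\<^bsub>I 0\<^esub>) q \<oplus>\<^bsub>I 1\<^esub> c' q)"
      using Q1.halo_HomD(2)[OF c1] by (auto simp: c'_def compose_def fun_eq_iff)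
    with z show ?thesis unfolding C_def H_def by blast
  qed
  with \<open>C = H\<close> obtain f where f: "f \<in> Q0.halo_Hom" "c' = compose (carrier Q) (d 0) f"
    by (auto simp: H_def)
  have "d 0 (f q) = c q" if "q \<in> carrier Q" for q
    using that c'_apply[of q] by (simp add: f(2) compose_def)
  with f(1) that show thesis by blast
qed

section \<open>Splitting\<close>

theorem corollary61:
  fixes K :: "('k, 'm) ring_scheme"
    and G :: "('g, 'n) monoid_scheme"
    and E :: "'e set"
    and \<phi> :: "'g \<Rightarrow> 'e \<Rightarrow> 'e"
    and Q W :: "('k, 'g \<times> 'e, 'u) digroup_rep"
    and \<eta> :: "'u \<Rightarrow> 'u"
    and I :: "nat \<Rightarrow> ('k, 'g \<times> 'e, 'u) digroup_rep"
    and d :: "nat \<Rightarrow> 'u \<Rightarrow> 'u"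
  defines "D \<equiv> action_digroup G E \<phi>"
  assumes "field K"
    and "\<forall>n::nat. n \<noteq> 0 \<longrightarrow> [n] \<cdot>\<^bsub>K\<^esub> \<one>\<^bsub>K\<^esub> \<noteq> \<zero>\<^bsub>K\<^esub>"
    and "group G" and "finite (carrier G)"
    and "group_action G E \<phi>" and "E \<noteq> {}"
    and "digroup_representation K D Q" and "digroup_representation K D W"
    and "rep_injective_resolution K D W \<eta> I d"
    and "module_injective_resolution (halo_algebra K E)
           (halo_module G W) \<eta> (\<lambda>n. halo_module G (I n)) d"
    and "halo_Ext1_invariants K G E Q I d = {\<one>\<^bsub>halo_Ext1 K G E Q I d\<^esub>}"
  shows "\<forall>(V :: ('k, 'g \<times> 'e, 'u) digroup_rep) i p.
           short_exact K D W i V p Q \<longrightarrow> splits K D V p Q"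
proof (intro allI impI)
  \<comment> \<open>Keeps the terms \<open>I 1\<close> and \<open>d 1\<close> from being rewritten to \<open>Suc 0\<close>.\<close>
  note [simp del] = One_nat_def
  fix V :: "('k, 'g \<times> 'e, 'u) digroup_rep" and i p
  assume ex: "short_exact K D W i V p Q"
  then have W: "digroup_representation K D W" and V: "digroup_representation K D V"
    and Q: "digroup_representation K D Q"
    and i: "i \<in> rep_hom K D W V" and p: "p \<in> rep_hom K D V Q" and inj_i: "inj_on i (carrier W)"
    and ker_p: "i ` carrier W = a_kernel V Q p" and surj: "p ` carrier V = carrier Q"
    by (simp_all add: short_exact_def)
  have inj: "rep_injective K D (I 0)" and I: "\<And>n. digroup_representation K D (I n)"
    and \<eta>: "\<eta> \<in> rep_hom K D W (I 0)" and d: "\<And>n. d n \<in> rep_hom K D (I n) (I (n + 1))"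
    and inj_\<eta>: "inj_on \<eta> (carrier W)" and ker_d0: "\<eta> ` carrier W = a_kernel (I 0) (I 1) (d 0)"
    and im_d0: "d 0 ` carrier (I 0) = a_kernel (I 1) (I 2) (d 1)"
    using assms(10)
    by (auto simp: rep_injective_resolution_def exact_coresolution_def rep_injective_def
        dest: spec[of _ 0] simp flip: numeral_2_eq_2)
  have d0: "d 0 \<in> rep_hom K D (I 0) (I 1)" using d[of 0] by simp
  note il = linear_homD(1)[OF rep_hom_linear[OF i]] and pl = linear_homD(1)[OF rep_hom_linear[OF p]]
  have act: "action_representation G E \<phi> K U" if "digroup_representation K D U"
    for U :: "('k, 'g \<times> 'e, 'u) digroup_rep"
    using that assms(6) by (simp add: action_representation_def D_def)
  have n: "[card (carrier G)] \<cdot>\<^bsub>K\<^esub> \<one>\<^bsub>K\<^esub> \<noteq> \<zero>\<^bsub>K\<^esub>"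
    using assms(3,5) monoid.one_closed[OF group.is_monoid[OF assms(4)]]
    by (metis card_eq_0_iff empty_iff)
  interpret av: averaging G E \<phi> K Q "I 0"
    using act[OF Q] act[OF I[of 0]] assms(5,7) n
    by (simp add: averaging_def averaging_axioms_def action_representation_pair_def
        action_representation_pair_axioms_def)
  interpret I1: digroup_representation K D "I 1" by (rule I)

  obtain h where h: "h \<in> rep_hom K D V (I 0)" and hi: "\<And>w. w \<in> carrier W \<Longrightarrow> h (i w) = \<eta> w"
    using inj i \<eta> W V inj_i unfolding rep_injective_def by meson
  have dh: "(\<lambda>v. d 0 (h v)) \<in> rep_hom K D V (I 1)" by (rule rep_hom_comp[OF h d0])
  have "d 0 (h v) = \<zero>\<^bsub>I 1\<^esub>" if "v \<in> a_kernel V Q p" for v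
  proof -
    obtain w where w: "w \<in> carrier W" "v = i w" using \<open>v \<in> a_kernel V Q p\<close> ker_p by blast
    then have "\<eta> w \<in> a_kernel (I 0) (I 1) (d 0)" using ker_d0 by blast
    then show ?thesis using w by (simp add: hi a_kernel_def')
  qed
  from rep_hom_factor_through_surj[OF V Q I p surj dh this]
  obtain c where c: "c \<in> rep_hom K D Q (I 1)" and cp: "\<And>v. v \<in> carrier V \<Longrightarrow> c (p v) = d 0 (h v)"
    by blast
  have hV: "h v \<in> carrier (I 0)" if "v \<in> carrier V" for v
    using linear_homD(1)[OF rep_hom_linear[OF h] that] .
  have "d 1 (c q) = \<zero>\<^bsub>I 2\<^esub>" if "q \<in> carrier Q" for q
  proof -
    obtain v where v: "v \<in> carrier V" "q = p v" using \<open>q \<in> carrier Q\<close> surj by blast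
    then have "c q \<in> d 0 ` carrier (I 0)" using cp hV by simp
    then show ?thesis by (simp add: im_d0 a_kernel_def')
  qed
  from equivariant_cocycle_is_coboundary[OF act[OF Q] act[OF I] assms(7) d[unfolded D_def]
      c[unfolded D_def] this assms(12)]
  obtain f where f: "f \<in> av.halo_Hom" and df: "\<And>q. q \<in> carrier Q \<Longrightarrow> d 0 (f q) = c q"
    by blast
  have av: "av.average f \<in> rep_hom K D Q (I 0)"
    unfolding D_def by (rule av.average_rep_hom[OF f])
  have dav: "d 0 (av.average f q) = c q" if "q \<in> carrier Q" for q
    by (rule av.average_lifts_rep_hom[OF act[OF I] d0[unfolded D_def] c[unfolded D_def] f df that])

  define h' where "h' = (\<lambda>v. h v \<ominus>\<^bsub>I 0\<^esub> av.average f (p v))"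
  have h': "h' \<in> rep_hom K D V (I 0)"
    unfolding h'_def by (rule rep_hom_diff[OF V I h rep_hom_comp[OF p av]])
  have avp: "av.average f (p v) \<in> carrier (I 0)" if "v \<in> carrier V" for v
    using linear_homD(1)[OF rep_hom_linear[OF av] pl[OF that]] .
  have "h' ` carrier V \<subseteq> \<eta> ` carrier W"
  proof
    fix x assume "x \<in> h' ` carrier V"
    then obtain v where v: "v \<in> carrier V" "x = h' v" by blast
    have "d 0 x = d 0 (h v) \<ominus>\<^bsub>I 1\<^esub> d 0 (av.average f (p v))"
      unfolding v h'_def
      by (rule linear_hom_minus_apply[OF av.J.abelian_group_axioms I1.abelian_group_axioms
          rep_hom_linear[OF d0] hV[OF v(1)] avp[OF v(1)]])
    also have "\<dots> = \<zero>\<^bsub>I 1\<^esub>"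
      using v linear_homD(1)[OF rep_hom_linear[OF dh]]
      by (simp add: dav pl cp a_minus_def I1.M.r_neg)
    finally show "x \<in> \<eta> ` carrier W"
      using linear_homD(1)[OF rep_hom_linear[OF h'] v(1)] v(2) by (simp add: ker_d0 a_kernel_def')
  qed
  from rep_hom_lift_through_inj[OF W \<eta> inj_\<eta> V h' this]
  obtain r where r: "r \<in> rep_hom K D V W" and \<eta>r: "\<And>v. v \<in> carrier V \<Longrightarrow> \<eta> (r v) = h' v"
    by blast
  have "r (i w) = w" if w: "w \<in> carrier W" for w
  proof -
    have "p (i w) = \<zero>\<^bsub>Q\<^esub>" using w ker_p by (auto simp: a_kernel_def')
    moreover have "av.average f \<zero>\<^bsub>Q\<^esub> = \<zero>\<^bsub>I 0\<^esub>"
      by (rule abelian_group_hom.hom_zero[OF linear_hom_abelian_group_hom[OF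
            av.Q.abelian_group_axioms av.J.abelian_group_axioms rep_hom_linear[OF av]]])
    ultimately have "\<eta> (r (i w)) = \<eta> w"
      using w hV[of "i w"] by (simp add: \<eta>r il h'_def hi a_minus_def)
    then show "r (i w) = w"
      using inj_\<eta> w linear_homD(1)[OF rep_hom_linear[OF r] il[OF w]] by (simp add: inj_on_def)
  qed
  with ex r show "splits K D V p Q" by (rule splits_if_retraction)
qed

end
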